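(* Let $X$ be a compact metric space, $f:X\to X$ a continuous map and $\mu\in\mathcal{M}(X,f)$ an $f$-invariant Borel probability measure. Then $$E_\mu(f)=\operatorname{ess\,sup}\{h_\mu(x):x\in X\},$$ where the essential supremum is taken with respect to $\mu$. If, in addition, $\mu$ is ergodic, then $$h_\mu(x)=E_\mu(f)=h_\mu(f)$$ for $\mu$-almost every $x\in X$.
   Context: Let $d$ be the metric on $X$. $\mathcal{M}(X,f)$ denotes the set of $f$-invariant Borel probability measures on $X$, and $h_\mu(f)$ is the Kolmogorov–Sinai entropy. Put $B_n(x,\epsilon)=\{y\in X:\max_{0\le i<n}d(f^ix,f^iy)<\epsilon\}$. The local entropy is $h_\mu(x)=\lim_{\epsilon\to0}\liminf_{n\to\infty}-\frac1n\log\mu(B_n(x,\epsilon))$. $E_\mu(f)$ (the measure theoretic pressure of the zero potential) is defined as follows. For $Z\subset X$, $\alpha\in\mathbb{R}$, $N\in\mathbb{N}$, $\epsilon>0$ let $$M(Z,\alpha,N,\epsilon)=\inf\Big\{\sum_ie^{-\alpha n_i}:\bigcup_iB_{n_i}(x_i,\epsilon)\supset Z,\ x_i\in X,\ n_i\ge N\text{ for all }i\Big\},$$ the infimum being over finite or countable families $(x_i,n_i)_i$; $m(Z,\alpha,\epsilon)=\lim_{N\to\infty}M(Z,\alpha,N,\epsilon)$; $E_Z(f,\epsilon)=\inf\{\alpha:m(Z,\alpha,\epsilon)=0\}=\sup\{\alpha:m(Z,\alpha,\epsilon)=+\infty\}$; $E_\mu(f,\epsilon)=\inf\{E_Z(f,\epsilon):\mu(Z)=1\}$;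 and $E_\mu(f)=\lim_{\epsilon\to0}E_\mu(f,\epsilon)$. *)

theory Defs
  imports "HOL-Probability.Probability"
begin

section \<open>Invariant and ergodic measures\<close>

definition invariant_measures :: "('a::topological_space \<Rightarrow> 'a) \<Rightarrow> 'a measure set" where
  "invariant_measures f =
     {\<mu>. prob_space \<mu> \<and> sets \<mu> = sets borel \<and> f \<in> measurable \<mu> \<mu> \<and> distr \<mu> \<mu> f = \<mu>}"

definition ergodic_measure :: "('a::topological_space \<Rightarrow> 'a) \<Rightarrow> 'a measure \<Rightarrow> bool" where
  "ergodic_measure f \<mu> \<longleftrightarrow>
     \<mu> \<in> invariant_measures f \<and>
     (\<forall>A\<in>sets \<mu>. f -` A \<inter> space \<mu> = A \<longrightarrow> measure \<mu> A = 0 \<or> measure \<mu> A = 1)"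


section \<open>Kolmogorov--Sinai entropy\<close>

definition finite_measurable_partitions :: "'a measure \<Rightarrow> 'a set set set" where
  "finite_measurable_partitions \<mu> = {P. finite P \<and> partition_on (space \<mu>) P \<and> P \<subseteq> sets \<mu>}"

text \<open>The convention \<open>0 * ln 0 = 0\<close> is automatic here.\<close>

definition partition_entropy :: "'a measure \<Rightarrow> 'a set set \<Rightarrow> real" where
  "partition_entropy \<mu> P = - (\<Sum>A\<in>P. measure \<mu> A * ln (measure \<mu> A))"

text \<open>The common refinement of \<open>P\<close>, \<open>f\<^sup>-\<^sup>1 P\<close>, \dots, \<open>f\<^sup>-\<^sup>(\<^sup>n\<^sup>-\<^sup>1\<^sup>) P\<close>: its nonempty atoms
  are given by the itineraries \<open>A 0, \<dots>, A (n - 1)\<close>.\<close>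

definition iterated_partition :: "'a measure \<Rightarrow> ('a \<Rightarrow> 'a) \<Rightarrow> 'a set set \<Rightarrow> nat \<Rightarrow> 'a set set" where
  "iterated_partition \<mu> f P n =
     (\<lambda>A. {x \<in> space \<mu>. \<forall>i<n. (f ^^ i) x \<in> A i}) ` (\<Pi>\<^sub>E i\<in>{..<n}. P) - {{}}"

definition partition_entropy_rate :: "'a measure \<Rightarrow> ('a \<Rightarrow> 'a) \<Rightarrow> 'a set set \<Rightarrow> real" where
  "partition_entropy_rate \<mu> f P =
     lim (\<lambda>n. partition_entropy \<mu> (iterated_partition \<mu> f P n) / real n)"

definition ks_entropy :: "'a measure \<Rightarrow> ('a \<Rightarrow> 'a) \<Rightarrow> ereal" where
  "ks_entropy \<mu> f =
     (SUP P\<in>finite_measurable_partitions \<mu>. ereal (partition_entropy_rate \<mu> f P))"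


section \<open>Local entropy\<close>

definition dyn_ball :: "('a::metric_space \<Rightarrow> 'a) \<Rightarrow> nat \<Rightarrow> 'a \<Rightarrow> real \<Rightarrow> 'a set" where
  "dyn_ball f n x \<epsilon> = {y. \<forall>i<n. dist ((f ^^ i) x) ((f ^^ i) y) < \<epsilon>}"

text \<open>\<open>- log p\<close> for \<open>p \<ge> 0\<close>, with \<open>- log 0 = \<infinity>\<close> (whereas \<open>ln 0 = 0\<close> on the reals).\<close>

definition neg_log :: "real \<Rightarrow> ereal" where
  "neg_log p = (if p = 0 then \<infinity> else ereal (- ln p))"

text \<open>The function of \<open>\<epsilon>\<close> below is antimonotone, so its limit at \<open>0\<close> from the right exists
  in the extended reals.\<close>

definition local_entropy :: "'a measure \<Rightarrow> ('a::metric_space \<Rightarrow> 'a) \<Rightarrow> 'a \<Rightarrow> ereal" where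
  "local_entropy \<mu> f x =
     Lim (at_right 0)
       (\<lambda>\<epsilon>. liminf (\<lambda>n. neg_log (measure \<mu> (dyn_ball f n x \<epsilon>)) / ereal (real n)))"


section \<open>Measure theoretic pressure of the zero potential\<close>

text \<open>Finite and countable families are indexed by arbitrary sets \<open>I\<close> of natural numbers;
  the infimum is \<open>\<infinity>\<close> if no such family covers \<open>Z\<close>.\<close>

definition cover_sum ::
  "('a::metric_space \<Rightarrow> 'a) \<Rightarrow> 'a set \<Rightarrow> real \<Rightarrow> nat \<Rightarrow> real \<Rightarrow> ennreal" where
  "cover_sum f Z \<alpha> N \<epsilon> =
     Inf {(\<Sum>\<^sub>\<infinity>i\<in>I. ennreal (exp (- \<alpha> * real (n i)))) | (I :: nat set) x n.
            Z \<subseteq> (\<Union>i\<in>I. dyn_ball f (n i) (x i) \<epsilon>) \<and> (\<forall>i\<in>I. N \<le> n i)}"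

definition cover_measure ::
  "('a::metric_space \<Rightarrow> 'a) \<Rightarrow> 'a set \<Rightarrow> real \<Rightarrow> real \<Rightarrow> ennreal" where
  "cover_measure f Z \<alpha> \<epsilon> = lim (\<lambda>N. cover_sum f Z \<alpha> N \<epsilon>)"

text \<open>This infimum is also the supremum of all \<open>\<alpha>\<close> with \<open>cover_measure f Z \<alpha> \<epsilon> = \<infinity>\<close>.\<close>

definition set_entropy_scale :: "('a::metric_space \<Rightarrow> 'a) \<Rightarrow> 'a set \<Rightarrow> real \<Rightarrow> ereal" where
  "set_entropy_scale f Z \<epsilon> = Inf {ereal \<alpha> | \<alpha>. cover_measure f Z \<alpha> \<epsilon> = 0}"

definition measure_entropy_scale ::
  "'a measure \<Rightarrow> ('a::metric_space \<Rightarrow> 'a) \<Rightarrow> real \<Rightarrow> ereal" where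
  "measure_entropy_scale \<mu> f \<epsilon> =
     (INF Z\<in>{Z \<in> sets \<mu>. emeasure \<mu> Z = 1}. set_entropy_scale f Z \<epsilon>)"

definition measure_pressure_zero :: "'a measure \<Rightarrow> ('a::metric_space \<Rightarrow> 'a) \<Rightarrow> ereal" where
  "measure_pressure_zero \<mu> f = Lim (at_right 0) (\<lambda>\<epsilon>. measure_entropy_scale \<mu> f \<epsilon>)"

end

theory Submission
  imports Defs
begin

text \<open>Let \<open>S\<close> be the essential supremum of the local entropy. Points \<open>x\<close> with
  \<open>\<mu> (B\<^sub>n (x, \<epsilon>)) \<ge> e\<^sup>-\<^sup>s\<^sup>n\<close> are covered by at most \<open>e\<^sup>s\<^sup>n\<close> dynamical balls of radius \<open>2\<epsilon>\<close>, and almost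
  every point is of this kind for infinitely many \<open>n\<close> if \<open>s > S\<close>; summing over \<open>n \<ge> N\<close> bounds the
  pressure by \<open>S\<close>, and the mass distribution principle gives the converse bound.

  Neither the ergodic theorem nor the Shannon--McMillan--Breiman theorem is needed for the entropy.
  For \<open>h\<^sub>\<mu>(f) \<le> S\<close> the balls above serve as the blocks of a code for the itineraries
  of a partition: an orbit is parsed greedily into blocks, and the few remaining symbols are coded one by
  one. Gibbs' inequality bounds the entropy by the mean code length, which only involves integrals of
  Birkhoff sums. In the ergodic case every local entropy function \<open>g\<close> is constant almost everywhere
  because \<open>g \<circ> f \<le> g\<close>, and if \<open>g > c\<close> at scale \<open>\<epsilon>\<close>, then most atoms of the iterates of a partition
  of diameter less than \<open>\<epsilon>\<close> have measure at most \<open>e\<^sup>-\<^sup>c\<^sup>n\<close>, so \<open>h\<^sub>\<mu>(f) \<ge> c\<close>.\<close>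

section \<open>Finite words over an alphabet and sums over them\<close>

definition words :: "'l set \<Rightarrow> nat \<Rightarrow> 'l list set" where
  "words A n = {w. set w \<subseteq> A \<and> length w = n}"

lemma finite_words: "finite A \<Longrightarrow> finite (words A n)"
  unfolding words_def by (rule finite_lists_length_eq)

lemma words_0 [simp]: "words A 0 = {[]}"
  by (auto simp: words_def)

lemma sum_words_append:
  "(\<Sum>w\<in>words A (m + n). g w) = (\<Sum>u\<in>words A m. \<Sum>v\<in>words A n. g (u @ v))"
proof -
  have "bij_betw (\<lambda>(u, v). u @ v) (words A m \<times> words A n) (words A (m + n))"
    by (rule bij_betwI[where g = "\<lambda>w. (take m w, drop m w)"])
       (auto simp: words_def dest: in_set_takeD in_set_dropD)
  from sum.reindex_bij_betw[OF this, of g] show ?thesis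
    by (simp add: sum.cartesian_product split_def)
qed

lemma sum_words_Suc:
  "(\<Sum>w\<in>words A (Suc n). g w) = (\<Sum>a\<in>A. \<Sum>w\<in>words A n. g (a # w))"
proof -
  have "bij_betw (\<lambda>(a, w). a # w) (A \<times> words A n) (words A (Suc n))"
    by (rule bij_betwI[where g = "\<lambda>w. (hd w, tl w)"])
       (auto simp: words_def length_Suc_conv)
  from sum.reindex_bij_betw[OF this, of g] show ?thesis
    by (simp add: sum.cartesian_product split_def)
qed

text \<open>The summand is the weight of \<open>w\<close> for independent letters, the
  \<open>j\<close>-th with subprobability weights \<open>c j\<close>. Splitting off the first letter
  shifts \<open>c\<close>, hence the induction over arbitrary \<open>c\<close>.\<close>

lemma sum_words_prod_le_1:
  fixes c :: "nat \<Rightarrow> 'l \<Rightarrow> real"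
  assumes "\<And>j a. c j a \<ge> 0" and "\<And>j. (\<Sum>a\<in>A. c j a) \<le> 1"
  shows "(\<Sum>w\<in>words A n. \<Prod>j<n. c j (w ! j)) \<le> 1"
  using assms
proof (induction n arbitrary: c)
  case (Suc n)
  have "(\<Sum>w\<in>words A (Suc n). \<Prod>j<Suc n. c j (w ! j))
      = (\<Sum>a\<in>A. c 0 a * (\<Sum>w\<in>words A n. \<Prod>j<n. c (Suc j) (w ! j)))"
    unfolding sum_words_Suc prod.lessThan_Suc_shift by (simp add: sum_distrib_left)
  also have "\<dots> \<le> (\<Sum>a\<in>A. c 0 a * 1)"
    using Suc.IH[of "\<lambda>j. c (Suc j)"] Suc.prems by (intro sum_mono mult_left_mono) auto
  also have "\<dots> \<le> 1"
    using Suc.prems by simp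
  finally show ?case .
qed simp

section \<open>A code from a family of blocks\<close>

context
  fixes k :: real and N :: "nat set" and r :: "'l list \<Rightarrow> real"
begin

text \<open>Total weight of all ways to parse \<open>w\<close> from the left into single letters,
  each of weight \<open>1 / (2 * k)\<close>, and blocks with lengths in \<open>N\<close>, weighted
  by \<open>r\<close>. Since all parsings are summed, each particular one gives a lower bound, and
  thus an upper bound for the code length \<open>- ln (renewal_code w)\<close>.\<close>

function renewal_code :: "'l list \<Rightarrow> real" where
  "renewal_code w =
     (if w = [] then 1
      else renewal_code (tl w) / (2 * k) +
           (\<Sum>n\<in>N \<inter> {1..length w}. r (take n w) * renewal_code (drop n w)))"
  by pat_completeness auto
termination by (relation "Wellfounded.measure length") auto

declare renewal_code.simps [simp del]

lemma renewal_code_Nil [simp]: "renewal_code [] = 1"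
  by (simp add: renewal_code.simps)

context
  assumes k: "k > 0" and r_nonneg: "\<And>w. r w \<ge> 0"
begin

text \<open>Spelling out the word letter by letter is always a parsing of positive weight, so every
  code length is finite.\<close>

lemma renewal_code_pos: "renewal_code w > 0"
proof (induction w rule: length_induct)
  case (1 w)
  show ?case
  proof (cases "w = []")
    case False
    then have "renewal_code (tl w) / (2 * k) > 0"
      using 1 k by auto
    moreover have "(\<Sum>n\<in>N \<inter> {1..length w}. r (take n w) * renewal_code (drop n w)) \<ge> 0"
      using 1 r_nonneg by (intro sum_nonneg mult_nonneg_nonneg) (auto simp: False intro!: less_imp_le)
    ultimately show ?thesis
      using False by (subst renewal_code.simps) auto
  qed simp
qed

lemma renewal_code_Cons: "renewal_code (a # w) \<ge> renewal_code w / (2 * k)"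
  by (subst renewal_code.simps)
     (auto intro!: sum_nonneg mult_nonneg_nonneg r_nonneg less_imp_le[OF renewal_code_pos])

lemma renewal_code_append:
  assumes "length u \<in> N" "u \<noteq> []"
  shows "renewal_code (u @ w) \<ge> r u * renewal_code w"
proof -
  let ?g = "\<lambda>n. r (take n (u @ w)) * renewal_code (drop n (u @ w))"
  have "r u * renewal_code w = ?g (length u)"
    by simp
  also have "\<dots> \<le> (\<Sum>n\<in>N \<inter> {1..length (u @ w)}. ?g n)"
    using assms
    by (intro member_le_sum) (auto simp: Suc_le_eq intro!: mult_nonneg_nonneg r_nonneg less_imp_le[OF renewal_code_pos])
  also have "\<dots> \<le> renewal_code (u @ w)"
    using assms k less_imp_le[OF renewal_code_pos, of "tl (u @ w)"]
    by (subst renewal_code.simps[of "u @ w"]) auto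
  finally show ?thesis .
qed

text \<open>Kraft's inequality for the code. The parsings that start with a letter contribute at
  most \<open>card A / (2 * k) \<le> 1 / 2\<close>, those that start with a block at most the total
  weight of the blocks, again \<open>1 / 2\<close>.\<close>

lemma sum_renewal_code_le_1:
  assumes A: "finite A" "real (card A) \<le> k"
    and N: "finite N" and r: "(\<Sum>n\<in>N. \<Sum>v\<in>words A n. r v) \<le> 1 / 2"
  shows "(\<Sum>w\<in>words A L. renewal_code w) \<le> 1"
proof (induction L rule: less_induct)
  case (less L)
  show ?case
  proof (cases L)
    case (Suc L')
    have "(\<Sum>w\<in>words A L. renewal_code w)
       = (\<Sum>w\<in>words A L. renewal_code (tl w) / (2 * k)) +
         (\<Sum>w\<in>words A L. \<Sum>n\<in>N \<inter> {1..L}. r (take n w) * renewal_code (drop n w))"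
      unfolding sum.distrib[symmetric]
      by (intro sum.cong refl, subst renewal_code.simps) (auto simp: words_def Suc)
    also have "(\<Sum>w\<in>words A L. renewal_code (tl w) / (2 * k))
        = card A / (2 * k) * (\<Sum>w\<in>words A L'. renewal_code w)"
      unfolding Suc sum_words_Suc by (simp add: sum_distrib_left sum_divide_distrib)
    also have "\<dots> \<le> 1 / 2 * 1"
      using A k less[of L'] Suc
      by (intro mult_mono) (auto simp: field_simps intro!: sum_nonneg less_imp_le[OF renewal_code_pos])
    also have "(\<Sum>w\<in>words A L. \<Sum>n\<in>N \<inter> {1..L}. r (take n w) * renewal_code (drop n w))
        = (\<Sum>n\<in>N \<inter> {1..L}. \<Sum>w\<in>words A L. r (take n w) * renewal_code (drop n w))"
      by (rule sum.swap)
    also have "\<dots> \<le> (\<Sum>n\<in>N \<inter> {1..L}. \<Sum>v\<in>words A n. r v)"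
    proof (rule sum_mono)
      fix n assume n: "n \<in> N \<inter> {1..L}"
      then have "(\<Sum>w\<in>words A L. r (take n w) * renewal_code (drop n w))
          = (\<Sum>u\<in>words A n. \<Sum>v\<in>words A (L - n). r (take n (u @ v)) * renewal_code (drop n (u @ v)))"
        using sum_words_append[of "\<lambda>w. r (take n w) * renewal_code (drop n w)" A n "L - n"] by simp
      also have "\<dots> = (\<Sum>u\<in>words A n. r u * (\<Sum>v\<in>words A (L - n). renewal_code v))"
        unfolding sum_distrib_left by (intro sum.cong) (auto simp: words_def)
      also have "\<dots> \<le> (\<Sum>u\<in>words A n. r u * 1)"
        \<comment> \<open>Block lengths start at 1, so \<open>L - n < L\<close> and the induction
          hypothesis applies.\<close>
        using n less[of "L - n"] by (intro sum_mono mult_left_mono r_nonneg) auto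
      finally show "(\<Sum>w\<in>words A L. r (take n w) * renewal_code (drop n w)) \<le> (\<Sum>v\<in>words A n. r v)"
        by simp
    qed
    also have "\<dots> \<le> (\<Sum>n\<in>N. \<Sum>v\<in>words A n. r v)"
      using N by (intro sum_mono2) (auto intro!: sum_nonneg r_nonneg)
    finally show ?thesis
      using r by simp
  qed simp
qed

end

end

section \<open>Gibbs' inequality and Fekete's lemma\<close>

text \<open>Termwise this is \<open>ln t \<le> t - 1\<close> at \<open>t = q i / p i\<close>. As
  \<open>ln 0 = 0\<close> here, \<open>ac\<close> excludes the terms for which the right-hand side
  ought to be infinite.\<close>

lemma gibbs_inequality:
  fixes p q :: "'i \<Rightarrow> real"
  assumes p: "\<And>i. i \<in> I \<Longrightarrow> p i \<ge> 0" "(\<Sum>i\<in>I. p i) = 1"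
    and q: "\<And>i. i \<in> I \<Longrightarrow> q i \<ge> 0" "(\<Sum>i\<in>I. q i) \<le> 1"
    and ac: "\<And>i. i \<in> I \<Longrightarrow> q i = 0 \<Longrightarrow> p i = 0"
  shows "- (\<Sum>i\<in>I. p i * ln (p i)) \<le> - (\<Sum>i\<in>I. p i * ln (q i))"
proof -
  have "(\<Sum>i\<in>I. p i * ln (q i) - p i * ln (p i)) \<le> (\<Sum>i\<in>I. q i - p i)"
  proof (rule sum_mono)
    fix i assume i: "i \<in> I"
    show "p i * ln (q i) - p i * ln (p i) \<le> q i - p i"
    proof (cases "p i = 0")
      case False
      then have pos: "p i > 0" "q i > 0"
        using p(1)[OF i] q(1)[OF i] ac[OF i] by force+
      have "p i * (ln (q i) - ln (p i)) \<le> p i * (q i / p i - 1)"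
        using pos ln_le_minus_one[of "q i / p i"] by (intro mult_left_mono) (auto simp: ln_div)
      then show ?thesis
        using pos by (simp add: algebra_simps)
    qed (use q i in auto)
  qed
  also have "\<dots> \<le> 0"
    using p q by (simp add: sum_subtractf)
  finally show ?thesis
    by (simp add: sum_subtractf)
qed

text \<open>The limit is the infimum \<open>l\<close> of the quotients: for a nearly optimal
  \<open>m\<close>, write \<open>n\<close> as a multiple of \<open>m\<close> plus a remainder and
  use subadditivity.\<close>

lemma fekete_convergent:
  fixes a :: "nat \<Rightarrow> real"
  assumes nonneg: "\<And>n. a n \<ge> 0" and sub: "\<And>m n. a (m + n) \<le> a m + a n"
  shows "convergent (\<lambda>n. a n / real n)"
proof -
  define l where "l = (INF n\<in>{1..}. a n / real n)"
  have bdd: "bdd_below ((\<lambda>n. a n / real n) ` {1..})"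
    by (rule bdd_belowI[of _ 0]) (auto intro!: divide_nonneg_nonneg nonneg)
  have mult: "a (q * m + r) \<le> real q * a m + a r" for q m r
  proof (induction q)
    case (Suc q)
    then show ?case
      using sub[of m "q * m + r"] by (simp add: algebra_simps)
  qed simp
  have "(\<lambda>n. a n / real n) \<longlonglongrightarrow> l"
  proof (rule LIMSEQ_I)
    fix e :: real assume e: "e > 0"
    obtain m where m: "m \<ge> 1" "a m / real m < l + e / 2"
      using cINF_less_iff[OF _ bdd, of "l + e / 2"] e unfolding l_def by auto
    define B where "B = Max (a ` {..<m})"
    have B: "a r \<le> B" if "r < m" for r
      unfolding B_def using that by auto
    have B0: "B \<ge> 0"
      using B[of 0] nonneg[of 0] m by auto
    \<comment> \<open>Beyond \<open>n0\<close> the bound \<open>B\<close> for the remainder is less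
      than \<open>e / 2 * n\<close>.\<close>
    obtain n0 where n0: "real n0 > 2 * B / e" "n0 \<ge> 1"
      by (metis reals_Archimedean2 less_le_trans of_nat_le_iff linorder_le_cases max.cobounded1)
    show "\<exists>n0. \<forall>n\<ge>n0. norm (a n / real n - l) < e"
    proof (intro exI allI impI)
      fix n assume n: "n \<ge> n0"
      have "l \<le> a n / real n"
        unfolding l_def using n n0 by (intro cINF_lower bdd) auto
      moreover have "a n / real n < l + e"
      proof -
        have "real n > 2 * B / e" "n > 0"
          using n n0 by auto
        then have Bn: "B < e / 2 * real n"
          using e by (simp add: field_simps)
        have "a n \<le> real (n div m) * a m + B"
          using mult[of "n div m" m "n mod m"] B[of "n mod m"] m by (simp add: mult.commute)
        also have "real (n div m) * a m = (a m / real m) * real (m * (n div m))"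
          using m by simp
        also have "\<dots> \<le> (a m / real m) * real n"
          using nonneg[of m] by (intro mult_left_mono) (simp_all only: of_nat_le_iff, simp_all)
        also have "\<dots> \<le> (l + e / 2) * real n"
          using m by (intro mult_right_mono) auto
        finally have "a n < (l + e) * real n"
          using Bn by (simp add: algebra_simps)
        then show ?thesis
          using \<open>n > 0\<close> by (simp add: field_simps)
      qed
      ultimately show "norm (a n / real n - l) < e"
        by simp
    qed
  qed
  then show ?thesis
    by (rule convergentI)
qed

section \<open>Measure-preserving maps\<close>

locale measure_preserving = prob_space M for M :: "'a measure" +
  fixes f :: "'a \<Rightarrow> 'a"
  assumes f_measurable [measurable]: "f \<in> measurable M M"
    and distr_f: "distr M M f = M"
begin

lemma funpow_measurable [measurable]: "f ^^ n \<in> measurable M M"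
  by (induction n) (auto intro: measurable_comp[OF _ f_measurable])

lemma funpow_in_space: "x \<in> space M \<Longrightarrow> (f ^^ n) x \<in> space M"
  using measurable_space[OF funpow_measurable] .

lemma distr_funpow: "distr M M (f ^^ n) = M"
proof (induction n)
  case 0
  show ?case
    using distr_id2[of M M] by (simp add: id_def)
next
  case (Suc n)
  have "distr M M (f ^^ Suc n) = distr (distr M M (f ^^ n)) M f"
    by (subst distr_distr) auto
  then show ?case
    using Suc distr_f by (simp add: o_def)
qed

text \<open>Consequently a Birkhoff sum of length \<open>L\<close> has \<open>L\<close> times the
  integral of its function.\<close>

lemma integral_funpow:
  fixes g :: "'a \<Rightarrow> real"
  assumes [measurable]: "g \<in> borel_measurable M"
  shows "(\<integral>x. g ((f ^^ n) x) \<partial>M) = (\<integral>x. g x \<partial>M)"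
  using integral_distr[of "f ^^ n" M M g] by (simp add: distr_funpow)

lemma integrable_funpow:
  fixes g :: "'a \<Rightarrow> real"
  assumes "integrable M g"
  shows "integrable M (\<lambda>x. g ((f ^^ n) x))"
  using integrable_distr[of "f ^^ n" M M g] assms by (simp add: distr_funpow)

lemma measure_vimage_f:
  assumes "A \<in> sets M"
  shows "measure M (f -` A \<inter> space M) = measure M A"
  using measure_distr[OF f_measurable assms] by (simp add: distr_f)

end

section \<open>Itineraries and the entropy of a finite partition\<close>

locale measure_preserving_partition = measure_preserving +
  fixes P :: "'a set set"
  assumes P: "P \<in> finite_measurable_partitions M"
begin

lemma finite_P: "finite P" and partition_P: "partition_on (space M) P" and P_sets: "A \<in> P \<Longrightarrow> A \<in> sets M"
  using P by (auto simp: finite_measurable_partitions_def)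

lemma P_nonempty: "P \<noteq> {}"
  using partition_onD1[OF partition_P] not_empty by auto

lemma card_P_pos: "card P > 0"
  using finite_P P_nonempty by (simp add: card_gt_0_iff)

definition cell :: "'a \<Rightarrow> 'a set" where
  "cell x = (THE A. A \<in> P \<and> x \<in> A)"

lemma cell_eq: "A \<in> P \<Longrightarrow> x \<in> A \<Longrightarrow> cell x = A"
  unfolding cell_def using partition_onD2[OF partition_P]
  by (intro the_equality) (auto dest: disjointD)

lemma cell_in_P: "x \<in> space M \<Longrightarrow> cell x \<in> P"
  and in_cell: "x \<in> space M \<Longrightarrow> x \<in> cell x"
  using partition_onD1[OF partition_P] cell_eq by auto

lemma cell_eq_iff: "A \<in> P \<Longrightarrow> x \<in> space M \<Longrightarrow> cell x = A \<longleftrightarrow> x \<in> A"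
  using cell_eq in_cell by auto

text \<open>Atoms of the iterated partition are handled through the itineraries that label them, so
  that sums over atoms become sums over words.\<close>

definition word :: "nat \<Rightarrow> 'a \<Rightarrow> 'a set list" where
  "word n x = map (\<lambda>i. cell ((f ^^ i) x)) [0..<n]"

definition cylinder :: "'a set list \<Rightarrow> 'a set" where
  "cylinder w = {x \<in> space M. word (length w) x = w}"

lemma length_word [simp]: "length (word n x) = n"
  by (simp add: word_def)

lemma word_nth [simp]: "i < n \<Longrightarrow> word n x ! i = cell ((f ^^ i) x)"
  by (simp add: word_def)

lemma word_in_words: "x \<in> space M \<Longrightarrow> word n x \<in> words P n"
  by (auto simp: word_def words_def cell_in_P funpow_in_space)

lemma word_add: "word (m + n) x = word m x @ word n ((f ^^ m) x)"
  by (rule nth_equalityI) (auto simp: nth_append funpow_add[THEN fun_cong, simplified, symmetric])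

lemma word_Suc: "word (Suc n) x = cell x # word n (f x)"
  using word_add[of 1 n x] by (simp add: word_def)

lemma cylinder_eq:
  assumes "w \<in> words P n"
  shows "cylinder w = {x \<in> space M. \<forall>i<n. (f ^^ i) x \<in> w ! i}"
proof -
  have "word (length w) x = w \<longleftrightarrow> (\<forall>i<n. (f ^^ i) x \<in> w ! i)" if "x \<in> space M" for x
  proof -
    have "w ! i \<in> P" if "i < n" for i
      using assms that by (auto simp: words_def)
    then show ?thesis
      using assms that by (auto simp: list_eq_iff_nth_eq words_def cell_eq_iff funpow_in_space)
  qed
  then show ?thesis
    by (auto simp: cylinder_def)
qed

lemma cylinder_sets:
  assumes "w \<in> words P n"
  shows "cylinder w \<in> sets M"
proof -
  have [measurable]: "w ! i \<in> sets M" if "i < n" for i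
    using assms that by (auto simp: words_def intro!: P_sets)
  have "cylinder w = {x \<in> space M. \<forall>i\<in>{..<n}. (f ^^ i) x \<in> w ! i}"
    using cylinder_eq[OF assms] by auto
  also have "\<dots> \<in> sets M"
    by (intro sets.sets_Collect_finite_All) auto
  finally show ?thesis .
qed

lemma in_cylinder_word: "x \<in> space M \<Longrightarrow> x \<in> cylinder (word n x)"
  by (simp add: cylinder_def)

text \<open>\<open>word n\<close> has finitely many values and measurable fibres, so functions of it
  are simple. This converts sums over words into integrals, to which invariance applies.\<close>

lemma has_integral_word:
  fixes g :: "'a set list \<Rightarrow> real"
  shows "has_bochner_integral M (\<lambda>x. g (word n x)) (\<Sum>w\<in>words P n. prob (cylinder w) * g w)"
proof -
  have "has_bochner_integral M (\<lambda>x. \<Sum>w\<in>words P n. indicator (cylinder w) x * g w)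
          (\<Sum>w\<in>words P n. prob (cylinder w) * g w)"
    using cylinder_sets
    by (intro has_bochner_integral_sum has_bochner_integral_mult_left has_bochner_integral_real_indicator)
       (auto simp: emeasure_eq_measure)
  moreover have "(\<Sum>w\<in>words P n. indicator (cylinder w) x * g w) = g (word n x)"
    if "x \<in> space M" for x
  proof -
    have "(\<Sum>w\<in>words P n. indicator (cylinder w) x * g w)
        = (\<Sum>w\<in>words P n. if w = word n x then g w else 0)"
      using that by (intro sum.cong) (auto simp: words_def cylinder_def indicator_def)
    then show ?thesis
      using that by (simp add: finite_words finite_P word_in_words)
  qed
  ultimately show ?thesis
    by (subst has_bochner_integral_cong[OF refl _ refl]) auto
qed

lemmas integrable_word = integrable.intros[OF has_integral_word]
lemmas integral_word = has_bochner_integral_integral_eq[OF has_integral_word]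

lemma sum_prob_cylinder: "(\<Sum>w\<in>words P n. prob (cylinder w)) = 1"
  using integral_word[of "\<lambda>_. 1" n] by (simp add: prob_space)

definition word_entropy :: "nat \<Rightarrow> real" where
  "word_entropy n = - (\<Sum>w\<in>words P n. prob (cylinder w) * ln (prob (cylinder w)))"

text \<open>Words with empty cylinder contribute 0; on the others \<open>cylinder\<close> is
  injective, because a point determines its word of length \<open>n\<close>.\<close>

lemma partition_entropy_iterated: "partition_entropy M (iterated_partition M f P n) = word_entropy n"
proof -
  let ?g = "\<lambda>A. prob A * ln (prob A)"
  have "(\<lambda>A. {x \<in> space M. \<forall>i<n. (f ^^ i) x \<in> A i}) ` (\<Pi>\<^sub>E i\<in>{..<n}. P) = cylinder ` words P n"
  proof (intro equalityI subsetI)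
    fix B assume "B \<in> (\<lambda>A. {x \<in> space M. \<forall>i<n. (f ^^ i) x \<in> A i}) ` (\<Pi>\<^sub>E i\<in>{..<n}. P)"
    then obtain A where A: "A \<in> (\<Pi>\<^sub>E i\<in>{..<n}. P)" "B = {x \<in> space M. \<forall>i<n. (f ^^ i) x \<in> A i}"
      by auto
    then have "map A [0..<n] \<in> words P n"
      by (auto simp: words_def)
    moreover from cylinder_eq[OF this] have "B = cylinder (map A [0..<n])"
      using A by auto
    ultimately show "B \<in> cylinder ` words P n"
      by blast
  next
    fix B assume "B \<in> cylinder ` words P n"
    then obtain w where w: "w \<in> words P n" "B = cylinder w"
      by auto
    then have "restrict (\<lambda>i. w ! i) {..<n} \<in> (\<Pi>\<^sub>E i\<in>{..<n}. P)"
      by (auto simp: words_def)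
    moreover have "B = {x \<in> space M. \<forall>i<n. (f ^^ i) x \<in> restrict (\<lambda>i. w ! i) {..<n} i}"
      using cylinder_eq[OF w(1)] w(2) by auto
    ultimately show "B \<in> (\<lambda>A. {x \<in> space M. \<forall>i<n. (f ^^ i) x \<in> A i}) ` (\<Pi>\<^sub>E i\<in>{..<n}. P)"
      by blast
  qed
  then have "partition_entropy M (iterated_partition M f P n) = - (\<Sum>A\<in>cylinder ` words P n - {{}}. ?g A)"
    by (simp add: partition_entropy_def iterated_partition_def)
  also have "cylinder ` words P n - {{}} = cylinder ` {w \<in> words P n. cylinder w \<noteq> {}}"
    by auto
  also have "(\<Sum>A\<in>\<dots>. ?g A) = (\<Sum>w\<in>{w \<in> words P n. cylinder w \<noteq> {}}. ?g (cylinder w))"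
    by (subst sum.reindex) (auto simp: inj_on_def cylinder_def words_def)
  also have "\<dots> = (\<Sum>w\<in>words P n. ?g (cylinder w))"
    by (intro sum.mono_neutral_left) (auto simp: finite_words finite_P)
  finally show ?thesis
    by (simp add: word_entropy_def)
qed

lemma word_entropy_nonneg: "word_entropy n \<ge> 0"
proof -
  have "(\<Sum>w\<in>words P n. prob (cylinder w) * ln (prob (cylinder w))) \<le> 0"
  proof (rule sum_nonpos)
    fix w
    show "prob (cylinder w) * ln (prob (cylinder w)) \<le> 0"
      by (cases "prob (cylinder w) = 0") (auto simp: mult_nonneg_nonpos zero_less_measure_iff)
  qed
  then show ?thesis
    by (simp add: word_entropy_def)
qed

text \<open>Gibbs' inequality read as a statement on codes: \<open>- ln (q w)\<close> is the length
  of the code of \<open>w\<close>, and the entropy is at most the mean length.\<close>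

lemma word_entropy_le_code:
  assumes "\<And>w. w \<in> words P n \<Longrightarrow> q w \<ge> 0" "(\<Sum>w\<in>words P n. q w) \<le> 1"
    and "\<And>w. w \<in> words P n \<Longrightarrow> q w = 0 \<Longrightarrow> prob (cylinder w) = 0"
  shows "word_entropy n \<le> (\<integral>x. - ln (q (word n x)) \<partial>M)"
  unfolding integral_word[of "\<lambda>w. - ln (q w)"] word_entropy_def
  using gibbs_inequality[of "words P n" "\<lambda>w. prob (cylinder w)" q] assms
  by (simp add: sum_negf sum_prob_cylinder)

lemma word_entropy_eq_integral: "word_entropy n = (\<integral>x. - ln (prob (cylinder (word n x))) \<partial>M)"
  unfolding integral_word[of "\<lambda>w. - ln (prob (cylinder w))"] word_entropy_def by (simp add: sum_negf)

text \<open>The code bound is applied to the weights that treat the first \<open>m\<close> and the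
  last \<open>n\<close> symbols as independent. By invariance the last \<open>n\<close> symbols have
  the law of the first \<open>n\<close>.\<close>

lemma word_entropy_add: "word_entropy (m + n) \<le> word_entropy m + word_entropy n"
proof -
  define q where "q = (\<lambda>w. prob (cylinder (take m w)) * prob (cylinder (drop m w)))"
  have sub: "cylinder w \<subseteq> cylinder (take m w)"
    "cylinder w \<subseteq> (f ^^ m) -` cylinder (drop m w) \<inter> space M" if "w \<in> words P (m + n)" for w
    using that by (auto simp: cylinder_def words_def funpow_in_space word_add)
  have split: "take m w \<in> words P m" "drop m w \<in> words P n" if "w \<in> words P (m + n)" for w
    using that by (auto simp: words_def dest: in_set_takeD in_set_dropD)
  have shift: "prob ((f ^^ m) -` cylinder v \<inter> space M) = prob (cylinder v)" if "v \<in> words P n" for v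
    using measure_distr[OF funpow_measurable cylinder_sets[OF that], of m] by (simp add: distr_funpow)
  have zero: "prob (cylinder w) = 0"
    if w: "w \<in> words P (m + n)" and q: "prob (cylinder (take m w)) = 0 \<or> prob (cylinder (drop m w)) = 0" for w
  proof -
    have "prob (cylinder w) \<le> prob (cylinder (take m w))"
      using sub(1)[OF w] split(1)[OF w] by (intro finite_measure_mono cylinder_sets)
    moreover have "prob (cylinder w) \<le> prob ((f ^^ m) -` cylinder (drop m w) \<inter> space M)"
      using sub(2)[OF w] cylinder_sets[OF split(2)[OF w]] by (intro finite_measure_mono) auto
    ultimately show ?thesis
      using q measure_nonneg[of M "cylinder w"] by (auto simp: shift[OF split(2)[OF w]] measure_le_0_iff)
  qed
  have "word_entropy (m + n) \<le> (\<integral>x. - ln (q (word (m + n) x)) \<partial>M)"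
  proof (rule word_entropy_le_code)
    have "(\<Sum>w\<in>words P (m + n). q w) = (\<Sum>u\<in>words P m. \<Sum>v\<in>words P n. prob (cylinder u) * prob (cylinder v))"
      unfolding sum_words_append q_def by (intro sum.cong) (auto simp: words_def)
    also have "\<dots> = 1"
      by (simp add: sum_distrib_left[symmetric] sum_prob_cylinder)
    finally show "(\<Sum>w\<in>words P (m + n). q w) \<le> 1"
      by simp
  qed (auto simp: q_def intro!: zero)
  also have "\<dots> = (\<Sum>w\<in>words P (m + n). prob (cylinder w) * - ln (q w))"
    by (rule integral_word)
  \<comment> \<open>The logarithm of the product splits only if both factors are positive; otherwise
    \<open>zero\<close> makes the coefficient vanish.\<close>
  also have "\<dots> = (\<Sum>w\<in>words P (m + n). prob (cylinder w) *
                (- ln (prob (cylinder (take m w))) + - ln (prob (cylinder (drop m w)))))"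
  proof (intro sum.cong refl)
    fix w assume w: "w \<in> words P (m + n)"
    show "prob (cylinder w) * - ln (q w) = prob (cylinder w) *
                (- ln (prob (cylinder (take m w))) + - ln (prob (cylinder (drop m w))))"
    proof (cases "prob (cylinder w) = 0")
      case False
      then have "prob (cylinder (take m w)) > 0" "prob (cylinder (drop m w)) > 0"
        using zero[OF w] by (auto simp: zero_less_measure_iff)
      then show ?thesis
        by (simp add: q_def ln_mult)
    qed simp
  qed
  also have "\<dots> = (\<integral>x. - ln (prob (cylinder (take m (word (m + n) x)))) +
                       - ln (prob (cylinder (drop m (word (m + n) x)))) \<partial>M)"
    by (rule integral_word[symmetric])
  also have "\<dots> = (\<integral>x. - ln (prob (cylinder (word m x))) + - ln (prob (cylinder (word n ((f ^^ m) x)))) \<partial>M)"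
    by (simp add: word_add)
  also have "\<dots> = (\<integral>x. - ln (prob (cylinder (word m x))) \<partial>M)
                  + (\<integral>x. - ln (prob (cylinder (word n ((f ^^ m) x)))) \<partial>M)"
    using integrable_funpow[OF integrable_word] integrable_word by (intro Bochner_Integration.integral_add)
  also have "\<dots> = word_entropy m + word_entropy n"
    unfolding word_entropy_eq_integral
    using integral_funpow[OF borel_measurable_integrable[OF integrable_word]] by simp
  finally show ?thesis .
qed

text \<open>Fekete's lemma shows that the \<open>lim\<close> in the definition of the entropy rate
  is a genuine limit.\<close>

lemma word_entropy_rate: "(\<lambda>n. word_entropy n / real n) \<longlonglongrightarrow> partition_entropy_rate M f P"
  unfolding partition_entropy_rate_def partition_entropy_iterated
  using fekete_convergent[of word_entropy] word_entropy_nonneg word_entropy_add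
  by (simp add: convergent_LIMSEQ_iff)

text \<open>Parsing the orbit of a point greedily into blocks bounds the length of its renewal code by
  a Birkhoff sum; the last \<open>K\<close> symbols may fail to contain a block and are coded one by one.\<close>

lemma partition_entropy_rate_le:
  fixes r :: "'a set list \<Rightarrow> real" and \<phi> :: "'a \<Rightarrow> real"
  defines "k \<equiv> real (card P)"
  assumes r_nonneg: "\<And>w. r w \<ge> 0"
    and N: "finite N" "N \<subseteq> {1..K}"
    and r: "(\<Sum>n\<in>N. \<Sum>v\<in>words P n. r v) \<le> 1 / 2"
    and \<phi>: "integrable M \<phi>" "\<And>x. \<phi> x \<ge> 0"
    and parse: "\<And>x. x \<in> space M \<Longrightarrow> \<phi> x \<ge> ln (2 * k) \<or>
       (\<exists>n\<in>N. r (word n x) > 0 \<and> - ln (r (word n x)) \<le> (\<Sum>j<n. \<phi> ((f ^^ j) x)))"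
  shows "partition_entropy_rate M f P \<le> (\<integral>x. \<phi> x \<partial>M)"
proof -
  let ?q = "renewal_code k N r"
  have k: "k > 0" "k \<ge> 1"
    unfolding k_def using card_P_pos by auto
  have lk: "ln (2 * k) \<ge> 0"
    using k by simp
  note q_pos = renewal_code_pos[of k r N, OF k(1) r_nonneg]
  \<comment> \<open>The price of one letter spelled out is \<open>ln (2 * k)\<close>, that of a
    block \<open>u\<close> is \<open>- ln (r u)\<close>.\<close>
  have Cons: "- ln (?q (a # w)) \<le> - ln (?q w) + ln (2 * k)" for a w
  proof -
    have "ln (?q w / (2 * k)) \<le> ln (?q (a # w))"
      using renewal_code_Cons[of k r N w a, OF k(1) r_nonneg] k(1) q_pos by (subst ln_le_cancel_iff) auto
    then show ?thesis
      using k(1) q_pos[of w] by (simp add: ln_div)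
  qed
  have append: "- ln (?q (u @ w)) \<le> - ln (r u) + - ln (?q w)" if "length u \<in> N" "r u > 0" for u w
  proof -
    have "u \<noteq> []"
      using that N by auto
    then have "ln (r u * ?q w) \<le> ln (?q (u @ w))"
      using renewal_code_append[of k r u N w, OF k(1) r_nonneg] that q_pos by (subst ln_le_cancel_iff) auto
    then show ?thesis
      using that q_pos[of w] by (simp add: ln_mult)
  qed
  \<comment> \<open>The term with \<open>min L K\<close> pays for spelling out the last symbols,
    when a block might run past the end of the word.\<close>
  have cost: "- ln (?q (word L x)) \<le> (\<Sum>j<L. \<phi> ((f ^^ j) x)) + real (min L K) * ln (2 * k)"
    if "x \<in> space M" for L x
    using that
  proof (induction L arbitrary: x rule: less_induct)
    case (less L)
    note x = less.prems
    have fx: "f x \<in> space M"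
      using funpow_in_space[OF x, of 1] by simp
    show ?case
    proof (cases L)
      case 0
      then show ?thesis by (simp add: word_def)
    next
      case (Suc L')
      have IH: "- ln (?q (word L x)) \<le> (\<Sum>j<L'. \<phi> ((f ^^ j) (f x))) + real (min L' K) * ln (2 * k) + ln (2 * k)"
        using Cons[of "cell x" "word L' (f x)"] less.IH[of L' "f x"] fx unfolding Suc word_Suc by simp
      have S: "(\<Sum>j<L. \<phi> ((f ^^ j) x)) = \<phi> x + (\<Sum>j<L'. \<phi> ((f ^^ j) (f x)))"
        unfolding Suc prod.lessThan_Suc_shift sum.lessThan_Suc_shift by (simp add: funpow_swap1)
      \<comment> \<open>For \<open>L > K\<close> each block fits. A letter is then paid by
        \<open>\<phi> x \<ge> ln (2 * k)\<close>, a block by the first \<open>n\<close> terms of the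
        Birkhoff sum. For \<open>L \<le> K\<close> the growth of \<open>min L K\<close> pays for the
        letter.\<close>
      consider "L \<le> K" | "L > K" "\<phi> x \<ge> ln (2 * k)"
        | n where "L > K" "n \<in> N" "r (word n x) > 0" "- ln (r (word n x)) \<le> (\<Sum>j<n. \<phi> ((f ^^ j) x))"
        using parse[OF x] by force
      then show ?thesis
      proof cases
        case 1
        then show ?thesis
          using IH S \<phi>(2)[of x] Suc by (simp add: algebra_simps)
      next
        case 2
        then have "min L' K = min L K"
          using Suc by simp
        then show ?thesis
          using 2 IH S by (simp add: algebra_simps)
      next
        case 3
        then have n: "1 \<le> n" "n \<le> K"
          using N by auto
        have "- ln (?q (word L x)) \<le> - ln (r (word n x)) + - ln (?q (word (L - n) ((f ^^ n) x)))"
          using word_add[of n "L - n" x] append[of "word n x"] 3 n by simp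
        also have "- ln (?q (word (L - n) ((f ^^ n) x)))
          \<le> (\<Sum>j<L - n. \<phi> ((f ^^ j) ((f ^^ n) x))) + real (min (L - n) K) * ln (2 * k)"
          using n Suc by (intro less.IH funpow_in_space x) auto
        also have "\<dots> \<le> (\<Sum>j<L - n. \<phi> ((f ^^ j) ((f ^^ n) x))) + real (min L K) * ln (2 * k)"
          using lk by (intro add_left_mono mult_right_mono) auto
        also have "(\<Sum>j<L - n. \<phi> ((f ^^ j) ((f ^^ n) x))) = (\<Sum>j\<in>{n..<L}. \<phi> ((f ^^ j) x))"
          using 3 n by (intro sum.reindex_bij_witness[of _ "\<lambda>j. j - n" "\<lambda>j. j + n"])
             (auto simp: funpow_add[THEN fun_cong, simplified, symmetric])
        finally have "- ln (?q (word L x)) \<le> (\<Sum>j<n. \<phi> ((f ^^ j) x)) + (\<Sum>j\<in>{n..<L}. \<phi> ((f ^^ j) x))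
             + real (min L K) * ln (2 * k)"
          using 3 by simp
        also have "(\<Sum>j<n. \<phi> ((f ^^ j) x)) + (\<Sum>j\<in>{n..<L}. \<phi> ((f ^^ j) x)) = (\<Sum>j<L. \<phi> ((f ^^ j) x))"
          using 3 n sum.atLeastLessThan_concat[of 0 n L "\<lambda>j. \<phi> ((f ^^ j) x)"] by (simp add: atLeast0LessThan)
        finally show ?thesis .
      qed
    qed
  qed
  have bound: "word_entropy L \<le> real L * (\<integral>x. \<phi> x \<partial>M) + real K * ln (2 * k)" for L
  proof -
    have "word_entropy L \<le> (\<integral>x. - ln (?q (word L x)) \<partial>M)"
      using q_pos sum_renewal_code_le_1[of k r P N, OF k(1) r_nonneg finite_P _ N(1) r]
      by (intro word_entropy_le_code) (auto simp: k_def intro: less_imp_le, metis less_irrefl)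
    also have "\<dots> \<le> (\<integral>x. (\<Sum>j<L. \<phi> ((f ^^ j) x)) + real K * ln (2 * k) \<partial>M)"
    proof (rule integral_mono)
      fix x assume "x \<in> space M"
      from cost[OF this, of L]
      show "- ln (?q (word L x)) \<le> (\<Sum>j<L. \<phi> ((f ^^ j) x)) + real K * ln (2 * k)"
        using lk mult_right_mono[of "real (min L K)" "real K" "ln (2 * k)"] by simp
    qed (intro integrable_word Bochner_Integration.integrable_add Bochner_Integration.integrable_sum
          integrable_funpow \<phi> integrable_const)+
    also have "\<dots> = (\<Sum>j<L. \<integral>x. \<phi> ((f ^^ j) x) \<partial>M) + real K * ln (2 * k)"
      by (simp add: integrable_funpow[OF \<phi>(1)] prob_space)
    also have "\<dots> = real L * (\<integral>x. \<phi> x \<partial>M) + real K * ln (2 * k)"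
      using integral_funpow[OF borel_measurable_integrable[OF \<phi>(1)]] by simp
    finally show ?thesis .
  qed
  \<comment> \<open>The cost of the end of the word does not grow with \<open>L\<close> and
    disappears from the rate.\<close>
  have "(\<lambda>L. (\<integral>x. \<phi> x \<partial>M) + real K * ln (2 * k) / real L) \<longlonglongrightarrow> (\<integral>x. \<phi> x \<partial>M) + 0"
    by (intro tendsto_intros tendsto_divide_0[OF tendsto_const] filterlim_at_top_imp_at_infinity
         filterlim_real_sequentially)
  moreover have "\<forall>\<^sub>F L in sequentially. word_entropy L / real L \<le> (\<integral>x. \<phi> x \<partial>M) + real K * ln (2 * k) / real L"
    using eventually_gt_at_top[of 0]
  proof eventually_elim
    case (elim L)
    then show ?case
      using divide_right_mono[OF bound[of L], of "real L"] by (simp add: add_divide_distrib)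
  qed
  ultimately have "partition_entropy_rate M f P \<le> (\<integral>x. \<phi> x \<partial>M) + 0"
    using word_entropy_rate by (intro tendsto_le[OF sequentially_bot])
  then show ?thesis by simp
qed

end

section \<open>Extended reals and limits as the scale tends to 0\<close>

lemma ereal_le_via_reals:
  fixes a b :: ereal
  assumes "\<And>s. a < ereal s \<Longrightarrow> b \<le> ereal s"
  shows "b \<le> a"
  by (meson assms ereal_dense2 not_le)

lemma Lim_at_right_0_antimono:
  fixes g :: "real \<Rightarrow> ereal"
  assumes "\<And>x y. 0 < x \<Longrightarrow> x \<le> y \<Longrightarrow> g y \<le> g x"
  shows "Lim (at_right 0) g = (SUP x\<in>{0<..}. g x)"
proof (rule tendsto_Lim)
  show "(g \<longlongrightarrow> (SUP x\<in>{0<..}. g x)) (at_right 0)"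
  proof (rule order_tendstoI)
    fix a assume "a < (SUP x\<in>{0<..}. g x)"
    then obtain x where x: "x > 0" "a < g x"
      by (auto simp: less_SUP_iff)
    then show "\<forall>\<^sub>F y in at_right 0. a < g y"
      unfolding eventually_at_right_field
      by (intro exI[of _ x]) (auto intro: less_le_trans[OF x(2) assms] x)
  next
    fix a assume a: "(SUP x\<in>{0<..}. g x) < a"
    have "g y < a" if "y > 0" for y
      using that a by (meson SUP_upper greaterThan_iff le_less_trans)
    then show "\<forall>\<^sub>F y in at_right 0. g y < a"
      unfolding eventually_at_right_field by (intro exI[of _ 1]) auto
  qed
qed simp

text \<open>Countably many scales suffice, which gives measurability and lets null sets be united
  over the scales.\<close>

lemma SUP_greaterThan_0_antimono:
  fixes g :: "real \<Rightarrow> ereal"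
  assumes "\<And>x y. 0 < x \<Longrightarrow> x \<le> y \<Longrightarrow> g y \<le> g x"
  shows "(SUP x\<in>{0<..}. g x) = (SUP n. g (1 / real (Suc n)))"
proof (rule antisym)
  show "(SUP x\<in>{0<..}. g x) \<le> (SUP n. g (1 / real (Suc n)))"
  proof (rule SUP_least)
    fix x :: real assume "x \<in> {0<..}"
    then obtain n where "1 / real (Suc n) < x"
      by (auto elim: nat_approx_posE)
    then have "g x \<le> g (1 / real (Suc n))"
      by (intro assms) auto
    then show "g x \<le> (SUP n. g (1 / real (Suc n)))"
      by (rule SUP_upper2[OF UNIV_I])
  qed
qed (auto intro!: SUP_least SUP_upper)

text \<open>Bounds on the local entropy become comparisons of ball measures with exponentials. For
  \<open>p = 0\<close> both sides are false.\<close>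

lemma neg_log_div_le_iff:
  assumes "p \<ge> 0" "n > 0"
  shows "neg_log p / ereal (real n) \<le> ereal s \<longleftrightarrow> exp (- s * real n) \<le> p"
proof (cases "p = 0")
  case False
  then have "exp (- s * real n) \<le> p \<longleftrightarrow> - s * real n \<le> ln p"
    using assms by (subst ln_ge_iff) auto
  also have "\<dots> \<longleftrightarrow> - ln p / real n \<le> s"
    using assms by (simp only: pos_divide_le_eq of_nat_0_less_iff) auto
  finally show ?thesis
    using False assms by (simp add: neg_log_def)
qed (use assms in \<open>simp add: neg_log_def\<close>)

section \<open>Dynamical balls\<close>

lemma dyn_ball_refl: "\<epsilon> > 0 \<Longrightarrow> x \<in> dyn_ball f n x \<epsilon>"
  by (simp add: dyn_ball_def)

lemma dyn_ball_commute: "y \<in> dyn_ball f n x \<epsilon> \<longleftrightarrow> x \<in> dyn_ball f n y \<epsilon>"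
  by (simp add: dyn_ball_def dist_commute)

lemma dyn_ball_triangle:
  assumes "y \<in> dyn_ball f n x \<epsilon>" "z \<in> dyn_ball f n y \<delta>"
  shows "z \<in> dyn_ball f n x (\<epsilon> + \<delta>)"
  unfolding dyn_ball_def mem_Collect_eq
proof (intro allI impI)
  fix i assume i: "i < n"
  then have "dist ((f ^^ i) x) ((f ^^ i) y) < \<epsilon>" "dist ((f ^^ i) y) ((f ^^ i) z) < \<delta>"
    using assms by (auto simp: dyn_ball_def)
  then show "dist ((f ^^ i) x) ((f ^^ i) z) < \<epsilon> + \<delta>"
    using dist_triangle[of "(f ^^ i) x" "(f ^^ i) z" "(f ^^ i) y"] by linarith
qed

lemma dyn_ball_mono: "\<epsilon> \<le> \<delta> \<Longrightarrow> dyn_ball f n x \<epsilon> \<subseteq> dyn_ball f n x \<delta>"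
  by (auto simp: dyn_ball_def intro: less_le_trans)

text \<open>Forgetting time 0 is the source of the inequality \<open>g \<circ> f \<le> g\<close> for
  the local entropies.\<close>

lemma dyn_ball_Suc_subset: "dyn_ball f (Suc n) x \<epsilon> \<subseteq> f -` dyn_ball f n (f x) \<epsilon>"
proof
  fix y assume y: "y \<in> dyn_ball f (Suc n) x \<epsilon>"
  have "dist ((f ^^ i) (f x)) ((f ^^ i) (f y)) < \<epsilon>" if "i < n" for i
    using y that by (auto simp: dyn_ball_def funpow_swap1 dest: spec[of _ "Suc i"])
  then show "y \<in> f -` dyn_ball f n (f x) \<epsilon>"
    by (simp add: dyn_ball_def)
qed

locale topological_system = measure_preserving M f for M :: "'a::metric_space measure" and f +
  assumes sets_M: "sets M = sets borel" and continuous_f: "continuous_on UNIV f"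
begin

lemma space_M [simp]: "space M = UNIV"
  using sets_eq_imp_space_eq[OF sets_M] by simp

lemma open_sets [intro]: "open A \<Longrightarrow> A \<in> sets M"
  by (simp add: sets_M)

lemma continuous_funpow: "continuous_on UNIV (f ^^ n)"
proof (induction n)
  case (Suc n)
  then show ?case
    using continuous_on_compose[OF Suc continuous_on_subset[OF continuous_f]] by simp
qed (simp add: id_def)

lemma open_dyn_ball: "open (dyn_ball f n x \<epsilon>)"
proof -
  have "dyn_ball f n x \<epsilon> = (\<Inter>i\<in>{..<n}. (f ^^ i) -` ball ((f ^^ i) x) \<epsilon>)"
    by (auto simp: dyn_ball_def)
  then show ?thesis
    using continuous_funpow by (auto intro!: open_INT open_vimage)
qed

lemma dyn_ball_sets [measurable, simp]: "dyn_ball f n x \<epsilon> \<in> sets M"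
  using open_dyn_ball by blast

lemma prob_dyn_ball_f: "prob (dyn_ball f (Suc n) x \<epsilon>) \<le> prob (dyn_ball f n (f x) \<epsilon>)"
proof -
  have "prob (dyn_ball f (Suc n) x \<epsilon>) \<le> prob (f -` dyn_ball f n (f x) \<epsilon> \<inter> space M)"
    using dyn_ball_Suc_subset[of f n x \<epsilon>] measurable_sets[OF f_measurable dyn_ball_sets]
    by (intro finite_measure_mono) auto
  then show ?thesis
    by (simp add: measure_vimage_f[OF dyn_ball_sets, simplified])
qed

text \<open>Lower semicontinuity in the centre. The ball is the increasing union of the balls
  \<open>B k\<close> of smaller radius, so some \<open>B k\<close> already has measure above
  \<open>a\<close>; it lies in the ball of every centre that stays within \<open>1 / (k + 1)\<close>
  of \<open>x\<close> for \<open>n\<close> steps.\<close>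

lemma open_prob_dyn_ball_greater: "open {x. a < prob (dyn_ball f n x \<epsilon>)}"
proof (subst open_subopen, intro ballI)
  fix x assume x: "x \<in> {x. a < prob (dyn_ball f n x \<epsilon>)}"
  define B where "B = (\<lambda>k. dyn_ball f n x (\<epsilon> - 1 / real (Suc k)))"
  have "incseq B"
    unfolding incseq_def B_def by (intro allI impI dyn_ball_mono diff_left_mono divide_left_mono) auto
  moreover have "(\<Union>k. B k) = dyn_ball f n x \<epsilon>"
  proof (intro equalityI subsetI)
    fix y assume y: "y \<in> dyn_ball f n x \<epsilon>"
    have "\<forall>\<^sub>F k in sequentially. \<forall>i\<in>{..<n}. dist ((f ^^ i) x) ((f ^^ i) y) < \<epsilon> - 1 / real (Suc k)"
    proof (intro eventually_ball_finite ballI)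
      fix i assume "i \<in> {..<n}"
      then have "dist ((f ^^ i) x) ((f ^^ i) y) < \<epsilon> - 0"
        using y by (simp add: dyn_ball_def)
      moreover have "(\<lambda>k. \<epsilon> - 1 / real (Suc k)) \<longlonglongrightarrow> \<epsilon> - 0"
        using LIMSEQ_inverse_real_of_nat by (intro tendsto_intros) (simp add: inverse_eq_divide)
      ultimately show "\<forall>\<^sub>F k in sequentially. dist ((f ^^ i) x) ((f ^^ i) y) < \<epsilon> - 1 / real (Suc k)"
        by (rule order_tendstoD(1)[rotated])
    qed simp
    then show "y \<in> (\<Union>k. B k)"
      by (auto simp: B_def dyn_ball_def dest!: eventually_happens)
  next
    fix y assume "y \<in> (\<Union>k. B k)"
    then obtain k where "y \<in> dyn_ball f n x (\<epsilon> - 1 / real (Suc k))"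
      by (auto simp: B_def)
    then show "y \<in> dyn_ball f n x \<epsilon>"
      using dyn_ball_mono[of "\<epsilon> - 1 / real (Suc k)" \<epsilon> f n x] by auto
  qed
  moreover have "range B \<subseteq> sets M"
    by (auto simp: B_def)
  ultimately have "(\<lambda>k. prob (B k)) \<longlonglongrightarrow> prob (dyn_ball f n x \<epsilon>)"
    using finite_Lim_measure_incseq[of B] by simp
  then have "\<forall>\<^sub>F k in sequentially. a < prob (B k)"
    using x by (intro order_tendstoD(1)[where y = "prob (dyn_ball f n x \<epsilon>)"]) auto
  then obtain k where k: "a < prob (B k)"
    by (auto dest: eventually_happens)
  have "dyn_ball f n x (1 / real (Suc k)) \<subseteq> {x. a < prob (dyn_ball f n x \<epsilon>)}"
  proof
    fix y assume "y \<in> dyn_ball f n x (1 / real (Suc k))"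
    then have "B k \<subseteq> dyn_ball f n y \<epsilon>"
      using dyn_ball_triangle[of x f n y "1 / real (Suc k)" _ "\<epsilon> - 1 / real (Suc k)"]
      by (auto simp: B_def dyn_ball_commute[of y])
    then have "prob (B k) \<le> prob (dyn_ball f n y \<epsilon>)"
      by (intro finite_measure_mono) auto
    then show "y \<in> {x. a < prob (dyn_ball f n x \<epsilon>)}"
      using k by simp
  qed
  then show "\<exists>T. open T \<and> x \<in> T \<and> T \<subseteq> {x. a < prob (dyn_ball f n x \<epsilon>)}"
    using open_dyn_ball dyn_ball_refl[of "1 / real (Suc k)" x f n] by (intro exI conjI) auto
qed

lemma prob_dyn_ball_measurable [measurable]: "(\<lambda>x. prob (dyn_ball f n x \<epsilon>)) \<in> borel_measurable M"
  unfolding borel_measurable_iff_greater using open_prob_dyn_ball_greater by auto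

section \<open>Local entropy at a fixed scale\<close>

definition scale_entropy :: "real \<Rightarrow> 'a \<Rightarrow> ereal" where
  "scale_entropy \<epsilon> x = liminf (\<lambda>n. neg_log (prob (dyn_ball f n x \<epsilon>)) / ereal (real n))"

lemma scale_entropy_measurable [measurable]: "scale_entropy \<epsilon> \<in> borel_measurable M"
  unfolding scale_entropy_def neg_log_def by measurable

text \<open>A liminf below \<open>s\<close> controls only infinitely many times, which depend on the
  point. Upper bounds must therefore combine many lengths \<open>n\<close>.\<close>

lemma scale_entropy_less_imp_frequently:
  assumes "scale_entropy \<epsilon> x < ereal s"
  shows "\<exists>\<^sub>F n in sequentially. exp (- s * real n) \<le> prob (dyn_ball f n x \<epsilon>)"
proof (rule ccontr)
  assume "\<not> ?thesis"
  then have "\<forall>\<^sub>F n in sequentially. ereal s \<le> neg_log (prob (dyn_ball f n x \<epsilon>)) / ereal (real n)"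
    unfolding not_frequently using eventually_gt_at_top[of 0]
  proof eventually_elim
    case (elim n)
    then show ?case
      using neg_log_div_le_iff[of "prob (dyn_ball f n x \<epsilon>)" n s] by simp
  qed
  then have "ereal s \<le> scale_entropy \<epsilon> x"
    unfolding scale_entropy_def by (rule Liminf_bounded)
  then show False
    using assms by simp
qed

lemma less_scale_entropy_imp_eventually:
  assumes "ereal s < scale_entropy \<epsilon> x"
  shows "\<forall>\<^sub>F n in sequentially. prob (dyn_ball f n x \<epsilon>) < exp (- s * real n)"
proof -
  have "\<forall>\<^sub>F n in sequentially. ereal s < neg_log (prob (dyn_ball f n x \<epsilon>)) / ereal (real n)"
    using assms unfolding scale_entropy_def by (rule less_LiminfD)
  then show ?thesis
    using eventually_gt_at_top[of 0]
  proof eventually_elim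
    case (elim n)
    then show ?case
      using neg_log_div_le_iff[of "prob (dyn_ball f n x \<epsilon>)" n s] by (metis not_le measure_nonneg)
  qed
qed

text \<open>The ball of \<open>f x\<close> for time \<open>n\<close> has at least the measure of the
  ball of \<open>x\<close> for time \<open>n + 1\<close>. The shift by one is absorbed in the gap
  between the rates \<open>t < s\<close>.\<close>

lemma scale_entropy_f_le: "scale_entropy \<epsilon> (f x) \<le> scale_entropy \<epsilon> x"
proof (rule ereal_le_via_reals)
  fix s assume "scale_entropy \<epsilon> x < ereal s"
  then obtain t where t: "scale_entropy \<epsilon> x < ereal t" "t < s"
    using ereal_dense2 by force
  show "scale_entropy \<epsilon> (f x) \<le> ereal s"
  proof (rule ccontr)
    assume "\<not> ?thesis"
    then have "\<forall>\<^sub>F n in sequentially. prob (dyn_ball f n (f x) \<epsilon>) < exp (- s * real n)"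
      by (intro less_scale_entropy_imp_eventually) simp
    \<comment> \<open>This threshold is equivalent to
      \<open>t * (n + 1) \<le> s * n\<close>.\<close>
    moreover have "\<forall>\<^sub>F n in sequentially. t / (s - t) \<le> real n"
      using filterlim_real_sequentially unfolding filterlim_at_top by blast
    ultimately have "\<forall>\<^sub>F n in sequentially. prob (dyn_ball f n (f x) \<epsilon>) < exp (- t * real (Suc n))"
    proof eventually_elim
      case (elim n)
      then have "- s * real n \<le> - t * real (Suc n)"
        using t(2) by (simp add: field_simps)
      then show ?case
        using elim by (meson exp_le_cancel_iff less_le_trans)
    qed
    then have "\<forall>\<^sub>F n in sequentially. prob (dyn_ball f (Suc n) x \<epsilon>) < exp (- t * real (Suc n))"
      by eventually_elim (rule le_less_trans[OF prob_dyn_ball_f])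
    then have "\<forall>\<^sub>F n in sequentially. prob (dyn_ball f n x \<epsilon>) < exp (- t * real n)"
      by (subst (asm) eventually_sequentially_Suc)
    with scale_entropy_less_imp_frequently[OF t(1)]
    show False
      by (simp only: frequently_def not_le not_True_eq_False simp_thms)
  qed
qed

lemma scale_entropy_antimono:
  assumes "\<epsilon> \<le> \<delta>"
  shows "scale_entropy \<delta> x \<le> scale_entropy \<epsilon> x"
proof (rule ereal_le_via_reals)
  fix s assume s: "scale_entropy \<epsilon> x < ereal s"
  show "scale_entropy \<delta> x \<le> ereal s"
  proof (rule ccontr)
    assume "\<not> ?thesis"
    then have "\<forall>\<^sub>F n in sequentially. prob (dyn_ball f n x \<delta>) < exp (- s * real n)"
      by (intro less_scale_entropy_imp_eventually) simp
    then have "\<forall>\<^sub>F n in sequentially. prob (dyn_ball f n x \<epsilon>) < exp (- s * real n)"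
    proof eventually_elim
      case (elim n)
      have "prob (dyn_ball f n x \<epsilon>) \<le> prob (dyn_ball f n x \<delta>)"
        using dyn_ball_mono[OF assms] by (intro finite_measure_mono) auto
      then show ?case
        using elim by simp
    qed
    with scale_entropy_less_imp_frequently[OF s]
    show False
      by (simp only: frequently_def not_le not_True_eq_False simp_thms)
  qed
qed

lemma local_entropy_eq_SUP: "local_entropy M f x = (SUP \<epsilon>\<in>{0<..}. scale_entropy \<epsilon> x)"
  unfolding local_entropy_def scale_entropy_def[symmetric]
  by (intro Lim_at_right_0_antimono scale_entropy_antimono)

lemma local_entropy_eq_SUP_seq: "local_entropy M f x = (SUP n. scale_entropy (1 / real (Suc n)) x)"
  unfolding local_entropy_eq_SUP
  by (intro SUP_greaterThan_0_antimono scale_entropy_antimono)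

lemma local_entropy_measurable [measurable]: "local_entropy M f \<in> borel_measurable M"
  unfolding local_entropy_eq_SUP_seq[abs_def] by measurable

lemma scale_entropy_le_local_entropy: "\<epsilon> > 0 \<Longrightarrow> scale_entropy \<epsilon> x \<le> local_entropy M f x"
  unfolding local_entropy_eq_SUP by (rule SUP_upper) simp

lemma local_entropy_f_le: "local_entropy M f (f x) \<le> local_entropy M f x"
  unfolding local_entropy_eq_SUP by (rule SUP_subset_mono[OF order_refl scale_entropy_f_le])

text \<open>\<open>E\<close> is a maximal set of such points whose balls of radius \<open>\<epsilon>\<close> are pairwise disjoint.\<close>

lemma separated_cover:
  assumes "\<epsilon> > 0"
  shows "\<exists>E. finite E \<and> real (card E) \<le> exp (s * real n) \<and>
     {x. exp (- s * real n) \<le> prob (dyn_ball f n x \<epsilon>)} \<subseteq> (\<Union>z\<in>E. dyn_ball f n z (2 * \<epsilon>))"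
proof -
  let ?big = "{x. exp (- s * real n) \<le> prob (dyn_ball f n x \<epsilon>)}"
  define S where "S = {E. finite E \<and> E \<subseteq> ?big \<and> disjoint_family_on (\<lambda>z. dyn_ball f n z \<epsilon>) E}"
  \<comment> \<open>Disjoint balls of measure at least \<open>exp (- s * n)\<close> have total mass
    at most 1.\<close>
  have card: "real (card E) \<le> exp (s * real n)" if "E \<in> S" for E
  proof -
    have "real (card E) * exp (- s * real n) = (\<Sum>z\<in>E. exp (- s * real n))"
      by simp
    also have "\<dots> \<le> (\<Sum>z\<in>E. prob (dyn_ball f n z \<epsilon>))"
      using that by (intro sum_mono) (auto simp: S_def)
    also have "\<dots> = prob (\<Union>z\<in>E. dyn_ball f n z \<epsilon>)"
      using that by (intro finite_measure_finite_Union[symmetric]) (auto simp: S_def)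
    also have "\<dots> \<le> 1"
      by simp
    finally show ?thesis
      by (simp add: exp_minus field_simps)
  qed
  \<comment> \<open>The bound on cardinalities provides a largest member of \<open>S\<close>, which
    no further point can extend.\<close>
  have "\<exists>E. E \<in> S \<and> (\<forall>E'. E' \<in> S \<longrightarrow> card E' \<le> card E)"
  proof (rule ex_has_greatest_nat)
    show "{} \<in> S"
      by (auto simp: S_def disjoint_family_on_def)
    show "\<forall>E. E \<in> S \<longrightarrow> card E < Suc (nat \<lfloor>exp (s * real n)\<rfloor>)"
      using card by (auto simp: less_Suc_eq_le le_nat_floor)
  qed
  then obtain E where E: "E \<in> S" and max: "\<And>E'. E' \<in> S \<Longrightarrow> card E' \<le> card E"
    by blast
  have "?big \<subseteq> (\<Union>z\<in>E. dyn_ball f n z (2 * \<epsilon>))"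
  proof
    fix x assume x: "x \<in> ?big"
    show "x \<in> (\<Union>z\<in>E. dyn_ball f n z (2 * \<epsilon>))"
    proof (rule ccontr)
      assume not: "x \<notin> (\<Union>z\<in>E. dyn_ball f n z (2 * \<epsilon>))"
      then have "x \<notin> E"
        using dyn_ball_refl[of "2 * \<epsilon>" x f n] assms by auto
      moreover have "dyn_ball f n x \<epsilon> \<inter> dyn_ball f n z \<epsilon> = {}" if "z \<in> E" for z
      proof (rule ccontr)
        assume "\<not> ?thesis"
        then obtain y where "y \<in> dyn_ball f n z \<epsilon>" "x \<in> dyn_ball f n y \<epsilon>"
          using dyn_ball_commute by blast
        then have "x \<in> dyn_ball f n z (2 * \<epsilon>)"
          using dyn_ball_triangle by fastforce
        then show False
          using not that by blast
      qed
      ultimately have "insert x E \<in> S"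
        using E x by (auto simp: S_def disjoint_family_on_insert)
      with max[of "insert x E"] E \<open>x \<notin> E\<close> show False
        by (simp add: S_def)
    qed
  qed
  then show ?thesis
    using E card[OF E] by (auto simp: S_def)
qed

end

section \<open>Cover sums and their monotonicity\<close>

lemma cover_sum_mono_N: "N \<le> N' \<Longrightarrow> cover_sum f Z \<alpha> N \<epsilon> \<le> cover_sum f Z \<alpha> N' \<epsilon>"
  unfolding cover_sum_def by (intro Inf_superset_mono) (use le_trans in blast)

lemma cover_sum_mono_scale:
  assumes "\<epsilon> \<le> \<delta>"
  shows "cover_sum f Z \<alpha> N \<delta> \<le> cover_sum f Z \<alpha> N \<epsilon>"
  unfolding cover_sum_def
proof (intro Inf_superset_mono subsetI)
  fix t assume "t \<in> {(\<Sum>\<^sub>\<infinity>i\<in>I. ennreal (exp (- \<alpha> * real (n i)))) |(I :: nat set) x n.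
            Z \<subseteq> (\<Union>i\<in>I. dyn_ball f (n i) (x i) \<epsilon>) \<and> (\<forall>i\<in>I. N \<le> n i)}"
  then obtain I :: "nat set" and x n where *: "t = (\<Sum>\<^sub>\<infinity>i\<in>I. ennreal (exp (- \<alpha> * real (n i))))"
    "Z \<subseteq> (\<Union>i\<in>I. dyn_ball f (n i) (x i) \<epsilon>)" "\<forall>i\<in>I. N \<le> n i"
    by blast
  moreover have "Z \<subseteq> (\<Union>i\<in>I. dyn_ball f (n i) (x i) \<delta>)"
    using *(2) by (rule order_trans) (intro UN_mono order_refl dyn_ball_mono assms)
  ultimately show "t \<in> {(\<Sum>\<^sub>\<infinity>i\<in>I. ennreal (exp (- \<alpha> * real (n i)))) |(I :: nat set) x n.
            Z \<subseteq> (\<Union>i\<in>I. dyn_ball f (n i) (x i) \<delta>) \<and> (\<forall>i\<in>I. N \<le> n i)}"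
    by blast
qed

text \<open>Monotonicity in \<open>N\<close> makes the \<open>lim\<close> a genuine limit.\<close>

lemma cover_measure_eq_SUP: "cover_measure f Z \<alpha> \<epsilon> = (SUP N. cover_sum f Z \<alpha> N \<epsilon>)"
  unfolding cover_measure_def
  by (intro limI LIMSEQ_SUP) (simp add: incseq_def cover_sum_mono_N)

lemma set_entropy_scale_antimono:
  assumes "\<epsilon> \<le> \<delta>"
  shows "set_entropy_scale f Z \<delta> \<le> set_entropy_scale f Z \<epsilon>"
proof -
  have "cover_measure f Z \<alpha> \<delta> \<le> cover_measure f Z \<alpha> \<epsilon>" for \<alpha>
    unfolding cover_measure_eq_SUP by (intro SUP_subset_mono order_refl cover_sum_mono_scale assms)
  then have "cover_measure f Z \<alpha> \<epsilon> = 0 \<Longrightarrow> cover_measure f Z \<alpha> \<delta> = 0" for \<alpha>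
    by (metis le_zero_eq)
  then show ?thesis
    unfolding set_entropy_scale_def by (intro Inf_superset_mono) blast
qed

lemma measure_entropy_scale_antimono:
  "\<epsilon> \<le> \<delta> \<Longrightarrow> measure_entropy_scale \<mu> f \<delta> \<le> measure_entropy_scale \<mu> f \<epsilon>"
  unfolding measure_entropy_scale_def
  by (intro INF_superset_mono order_refl set_entropy_scale_antimono)

lemma measure_pressure_zero_eq_SUP:
  "measure_pressure_zero \<mu> f = (SUP \<epsilon>\<in>{0<..}. measure_entropy_scale \<mu> f \<epsilon>)"
  unfolding measure_pressure_zero_def
  by (intro Lim_at_right_0_antimono measure_entropy_scale_antimono)

text \<open>Covers are indexed by sets of naturals in the definition; enumerating \<open>C\<close>
  makes every countable set of pairs of a length and a centre admissible.\<close>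

lemma cover_sum_le_countable:
  fixes C :: "(nat \<times> 'a::metric_space) set"
  assumes "countable C" "Z \<subseteq> (\<Union>(n, x)\<in>C. dyn_ball f n x \<epsilon>)" "\<And>n x. (n, x) \<in> C \<Longrightarrow> N \<le> n"
  shows "cover_sum f Z \<alpha> N \<epsilon> \<le> (\<Sum>\<^sub>\<infinity>(n, x)\<in>C. ennreal (exp (- \<alpha> * real n)))"
proof -
  let ?h = "to_nat_on C" and ?g = "from_nat_into C"
  have g: "?g (?h c) = c" if "c \<in> C" for c
    using that assms(1) by simp
  have "(\<Sum>\<^sub>\<infinity>(n, x)\<in>C. ennreal (exp (- \<alpha> * real n)))
      = (\<Sum>\<^sub>\<infinity>c\<in>C. ennreal (exp (- \<alpha> * real (fst (?g (?h c))))))"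
    by (intro infsum_cong) (auto simp: g)
  also have "\<dots> = (\<Sum>\<^sub>\<infinity>i\<in>?h ` C. ennreal (exp (- \<alpha> * real (fst (?g i)))))"
    using inj_on_to_nat_on[OF assms(1)] by (simp add: infsum_reindex o_def)
  finally have eq: "(\<Sum>\<^sub>\<infinity>(n, x)\<in>C. ennreal (exp (- \<alpha> * real n)))
      = (\<Sum>\<^sub>\<infinity>i\<in>?h ` C. ennreal (exp (- \<alpha> * real (fst (?g i)))))" .
  have "Z \<subseteq> (\<Union>i\<in>?h ` C. dyn_ball f (fst (?g i)) (snd (?g i)) \<epsilon>)"
    using assms(2) by (auto simp: g split_def)
  moreover have "\<forall>i\<in>?h ` C. N \<le> fst (?g i)"
    using assms(3) by (auto simp: g)
  ultimately show ?thesis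
    unfolding eq cover_sum_def
    by (intro Inf_lower CollectI exI[of _ "?h ` C"] exI[of _ "\<lambda>i. snd (?g i)"] exI[of _ "\<lambda>i. fst (?g i)"]) auto
qed

lemma sum_power_le_geometric_tail:
  fixes q :: real
  assumes q: "0 \<le> q" "q < 1"
  shows "(\<Sum>n\<in>{N..<m}. q ^ n) \<le> q ^ N / (1 - q)"
proof (cases "N \<le> m")
  case True
  then have "(\<Sum>n\<in>{N..<m}. q ^ n) * (1 - q) = q ^ N - q ^ m"
    by (induction m rule: dec_induct) (auto simp: ring_distribs)
  also have "\<dots> \<le> q ^ N"
    using q by simp
  finally show ?thesis
    using q by (simp add: pos_le_divide_eq)
qed (use q in auto)

text \<open>The infinite sum is the supremum over finite subfamilies, and each of these lies over a
  bounded range of \<open>n\<close>.\<close>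

lemma ennreal_infsum_Sigma_le_geometric:
  fixes E :: "nat \<Rightarrow> 'b set"
  assumes fin: "\<And>n. finite (E n)" and q: "0 \<le> q" "q < 1"
    and le: "\<And>n. real (card (E n)) * a n \<le> q ^ n" and a: "\<And>n. a n \<ge> 0"
  shows "(\<Sum>\<^sub>\<infinity>(n, x)\<in>(SIGMA n:{N..}. E n). ennreal (a n)) \<le> ennreal (q ^ N / (1 - q))"
proof -
  have "(\<Sum>(n, x)\<in>F. ennreal (a n)) \<le> ennreal (q ^ N / (1 - q))"
    if F: "finite F" "F \<subseteq> (SIGMA n:{N..}. E n)" for F
  proof -
    \<comment> \<open>Inserting 0 keeps \<open>Max\<close> defined for empty
      \<open>F\<close>.\<close>
    define m where "m = Suc (Max (insert 0 (fst ` F)))"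
    have "F \<subseteq> (SIGMA n:{N..<m}. E n)"
    proof
      fix c assume c: "c \<in> F"
      then have "fst c < m"
        using F(1) unfolding m_def less_Suc_eq_le by (intro Max_ge) auto
      then show "c \<in> (SIGMA n:{N..<m}. E n)"
        using c F(2) by auto
    qed
    then have "(\<Sum>(n, x)\<in>F. a n) \<le> (\<Sum>(n, x)\<in>(SIGMA n:{N..<m}. E n). a n)"
      using fin a by (intro sum_mono2) auto
    also have "\<dots> = (\<Sum>n\<in>{N..<m}. real (card (E n)) * a n)"
      using fin by (simp add: sum.Sigma[symmetric])
    also have "\<dots> \<le> (\<Sum>n\<in>{N..<m}. q ^ n)"
      by (intro sum_mono le)
    also have "\<dots> \<le> q ^ N / (1 - q)"
      by (rule sum_power_le_geometric_tail[OF q])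
    finally show ?thesis
      using a by (simp add: split_def ennreal_leI sum_ennreal)
  qed
  then show ?thesis
    by (subst nonneg_infsum_complete) (auto intro!: SUP_least)
qed

section \<open>The pressure as the essential supremum of the local entropy\<close>

context topological_system
begin

text \<open>Each point of \<open>Z\<close> has a large ball for some \<open>n \<ge> N\<close>, so
  the sets from \<open>separated_cover\<close> with \<open>n \<ge> N\<close> together cover
  \<open>Z\<close>. Their cost is a tail of the geometric series with ratio
  \<open>exp (- (\<alpha> - s))\<close>.\<close>

lemma set_entropy_scale_le:
  assumes \<epsilon>: "\<epsilon> > 0" and "s < \<alpha>"
    and freq: "\<And>x. x \<in> Z \<Longrightarrow> \<exists>\<^sub>F n in sequentially. exp (- s * real n) \<le> prob (dyn_ball f n x \<epsilon>)"
  shows "set_entropy_scale f Z (2 * \<epsilon>) \<le> ereal \<alpha>"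
proof -
  let ?big = "\<lambda>n. {x. exp (- s * real n) \<le> prob (dyn_ball f n x \<epsilon>)}"
  define q where "q = exp (- (\<alpha> - s))"
  have q: "0 \<le> q" "q < 1"
    using assms by (auto simp: q_def)
  obtain E where E: "\<And>n. finite (E n)" "\<And>n. real (card (E n)) \<le> exp (s * real n)"
    "\<And>n. ?big n \<subseteq> (\<Union>z\<in>E n. dyn_ball f n z (2 * \<epsilon>))"
    using separated_cover[OF \<epsilon>, of s] by metis
  have bound: "cover_sum f Z \<alpha> N (2 * \<epsilon>) \<le> ennreal (q ^ N / (1 - q))" for N
  proof -
    have "cover_sum f Z \<alpha> N (2 * \<epsilon>)
        \<le> (\<Sum>\<^sub>\<infinity>(n, x)\<in>(SIGMA n:{N..}. E n). ennreal (exp (- \<alpha> * real n)))"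
    proof (rule cover_sum_le_countable)
      show "countable (SIGMA n:{N..}. E n)"
        using E(1) by (intro countable_SIGMA) (auto intro: countable_finite)
      show "Z \<subseteq> (\<Union>(n, x)\<in>(SIGMA n:{N..}. E n). dyn_ball f n x (2 * \<epsilon>))"
      proof
        fix x assume "x \<in> Z"
        from freq[OF this] obtain n where n: "n \<ge> N" "x \<in> ?big n"
          unfolding frequently_sequentially by auto
        then obtain z where "z \<in> E n" "x \<in> dyn_ball f n z (2 * \<epsilon>)"
          using E(3) by blast
        then show "x \<in> (\<Union>(n, x)\<in>(SIGMA n:{N..}. E n). dyn_ball f n x (2 * \<epsilon>))"
          using n by force
      qed
    qed auto
    also have "\<dots> \<le> ennreal (q ^ N / (1 - q))"
    proof (rule ennreal_infsum_Sigma_le_geometric[OF E(1) q])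
      fix n
      have "real (card (E n)) * exp (- \<alpha> * real n) \<le> exp (s * real n) * exp (- \<alpha> * real n)"
        using E(2) by (intro mult_right_mono) auto
      also have "\<dots> = q ^ n"
        by (simp add: q_def exp_add[symmetric] exp_of_nat_mult[symmetric] algebra_simps)
      finally show "real (card (E n)) * exp (- \<alpha> * real n) \<le> q ^ n" .
    qed auto
    finally show ?thesis .
  qed
  have lim: "(\<lambda>N. ennreal (q ^ N / (1 - q))) \<longlonglongrightarrow> ennreal (0 / (1 - q))"
    using q by (intro tendsto_ennrealI tendsto_divide LIMSEQ_power_zero tendsto_const) auto
  have "(\<lambda>N. cover_sum f Z \<alpha> N (2 * \<epsilon>)) \<longlonglongrightarrow> 0"
    by (rule tendsto_sandwich[OF _ _ tendsto_const])
       (use bound lim in \<open>auto intro!: always_eventually\<close>)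
  then have "cover_measure f Z \<alpha> (2 * \<epsilon>) = 0"
    unfolding cover_measure_def by (rule limI)
  then show ?thesis
    unfolding set_entropy_scale_def by (intro Inf_lower) auto
qed

text \<open>The points whose local entropy is at most the essential supremum form a set of full
  measure, which competes in the infimum over \<open>Z\<close>.\<close>

lemma measure_pressure_zero_le: "measure_pressure_zero M f \<le> esssup M (local_entropy M f)"
  unfolding measure_pressure_zero_eq_SUP
proof (rule SUP_least)
  fix \<epsilon> :: real assume \<epsilon>: "\<epsilon> \<in> {0<..}"
  let ?S = "esssup M (local_entropy M f)"
  define Z where "Z = {x \<in> space M. local_entropy M f x \<le> ?S}"
  have Z: "Z \<in> sets M"
    unfolding Z_def by measurable
  moreover have "emeasure M Z = 1"
  proof -
    have "AE x in M. x \<in> Z"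
      using esssup_AE[of "local_entropy M f" M] by (auto simp: Z_def)
    then show ?thesis
      using Z emeasure_eq_1_AE by blast
  qed
  ultimately have "measure_entropy_scale M f \<epsilon> \<le> set_entropy_scale f Z \<epsilon>"
    unfolding measure_entropy_scale_def by (intro INF_lower) auto
  also have "\<dots> \<le> ?S"
  proof (rule ereal_le_via_reals)
    fix \<alpha> assume "?S < ereal \<alpha>"
    then obtain s where s: "?S < ereal s" "s < \<alpha>"
      using ereal_dense2 by force
    \<comment> \<open>Halving the scale makes up for the doubled radius of the covering
      balls.\<close>
    have "set_entropy_scale f Z (2 * (\<epsilon> / 2)) \<le> ereal \<alpha>"
    proof (rule set_entropy_scale_le[OF _ s(2)])
      fix x assume "x \<in> Z"
      then have "scale_entropy (\<epsilon> / 2) x < ereal s"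
        using s(1) scale_entropy_le_local_entropy[of "\<epsilon> / 2" x] \<epsilon> by (auto simp: Z_def)
      then show "\<exists>\<^sub>F n in sequentially. exp (- s * real n) \<le> prob (dyn_ball f n x (\<epsilon> / 2))"
        by (rule scale_entropy_less_imp_frequently)
    qed (use \<epsilon> in auto)
    then show "set_entropy_scale f Z \<epsilon> \<le> ereal \<alpha>"
      by simp
  qed
  finally show "measure_entropy_scale M f \<epsilon> \<le> ?S" .
qed

text \<open>Mass distribution principle. A covering ball that meets \<open>D\<close> lies in a ball
  of radius \<open>2 * \<epsilon>\<close> centred in \<open>D\<close>, so its measure is at most its
  term in the sum; the covering balls carry all of the measure of \<open>D\<close>.\<close>

lemma cover_sum_ge:
  assumes Z: "Z \<in> sets M" "emeasure M Z = 1" and "\<alpha> \<le> c" and N: "N\<^sub>0 \<le> N"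
    and D: "D \<in> sets M" "\<And>x n. x \<in> D \<Longrightarrow> n \<ge> N\<^sub>0 \<Longrightarrow> prob (dyn_ball f n x (2 * \<epsilon>)) \<le> exp (- c * real n)"
  shows "emeasure M D \<le> cover_sum f Z \<alpha> N \<epsilon>"
  unfolding cover_sum_def
proof (rule Inf_greatest)
  fix t assume "t \<in> {(\<Sum>\<^sub>\<infinity>i\<in>I. ennreal (exp (- \<alpha> * real (n i)))) |(I :: nat set) x n.
            Z \<subseteq> (\<Union>i\<in>I. dyn_ball f (n i) (x i) \<epsilon>) \<and> (\<forall>i\<in>I. N \<le> n i)}"
  then obtain I :: "nat set" and x n where t: "t = (\<Sum>\<^sub>\<infinity>i\<in>I. ennreal (exp (- \<alpha> * real (n i))))"
    and cover: "Z \<subseteq> (\<Union>i\<in>I. dyn_ball f (n i) (x i) \<epsilon>)" and n: "\<And>i. i \<in> I \<Longrightarrow> N \<le> n i"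
    by blast
  \<comment> \<open>Empty sets outside \<open>I\<close> allow countable subadditivity over all
    naturals.\<close>
  define B where "B i = (if i \<in> I then D \<inter> dyn_ball f (n i) (x i) \<epsilon> else {})" for i
  have B: "range B \<subseteq> sets M"
    using D(1) by (auto simp: B_def)
  have emB: "emeasure M (B i) \<le> (if i \<in> I then ennreal (exp (- \<alpha> * real (n i))) else 0)" for i
  proof (cases "B i = {}")
    case False
    then obtain y where y: "i \<in> I" "y \<in> D" "y \<in> dyn_ball f (n i) (x i) \<epsilon>"
      by (auto simp: B_def split: if_splits)
    have "B i \<subseteq> dyn_ball f (n i) y (2 * \<epsilon>)"
    proof
      fix z assume "z \<in> B i"
      then have "z \<in> dyn_ball f (n i) (x i) \<epsilon>"
        by (auto simp: B_def split: if_splits)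
      then show "z \<in> dyn_ball f (n i) y (2 * \<epsilon>)"
        using dyn_ball_triangle[of "x i" f "n i" y \<epsilon> z \<epsilon>] y(3) by (simp add: dyn_ball_commute[of "x i"])
    qed
    then have "prob (B i) \<le> prob (dyn_ball f (n i) y (2 * \<epsilon>))"
      by (intro finite_measure_mono) auto
    also have "\<dots> \<le> exp (- c * real (n i))"
      using n[OF y(1)] N y by (intro D(2)) auto
    also have "\<dots> \<le> exp (- \<alpha> * real (n i))"
      using \<open>\<alpha> \<le> c\<close> by (simp add: mult_right_mono)
    finally show ?thesis
      using y(1) by (simp add: emeasure_eq_measure ennreal_leI)
  qed simp
  have "emeasure M D = emeasure M (Z \<inter> D)"
  proof (rule emeasure_eq_AE)
    have "AE x in M. x \<in> Z"
      using Z emeasure_eq_1_AE[of Z] AE_in_set_eq_1[of Z] by (simp add: emeasure_eq_measure)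
    then show "AE x in M. x \<in> D \<longleftrightarrow> x \<in> Z \<inter> D"
      by eventually_elim auto
  qed (use Z D in auto)
  also have "\<dots> \<le> emeasure M (\<Union>i. B i)"
  proof (rule emeasure_mono)
    show "Z \<inter> D \<subseteq> (\<Union>i. B i)"
    proof
      fix y assume y: "y \<in> Z \<inter> D"
      then obtain i where "i \<in> I" "y \<in> dyn_ball f (n i) (x i) \<epsilon>"
        using cover by blast
      then have "y \<in> B i"
        using y by (simp add: B_def)
      then show "y \<in> (\<Union>i. B i)"
        by blast
    qed
  qed (use B in auto)
  also have "\<dots> \<le> (\<Sum>i. emeasure M (B i))"
    using B by (rule emeasure_subadditive_countably)
  also have "\<dots> \<le> (\<Sum>i. if i \<in> I then ennreal (exp (- \<alpha> * real (n i))) else 0)"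
    by (intro suminf_le emB) auto
  also have "\<dots> = (SUP m. \<Sum>i<m. if i \<in> I then ennreal (exp (- \<alpha> * real (n i))) else 0)"
    by (rule suminf_eq_SUP)
  also have "\<dots> \<le> t"
  proof (rule SUP_least)
    fix m
    have "(\<Sum>i<m. if i \<in> I then ennreal (exp (- \<alpha> * real (n i))) else 0)
        = (\<Sum>i\<in>{..<m} \<inter> I. ennreal (exp (- \<alpha> * real (n i))))"
      by (rule sum.inter_restrict[symmetric]) simp
    also have "\<dots> \<le> t"
      unfolding t by (subst nonneg_infsum_complete) (auto intro!: SUP_upper)
    finally show "(\<Sum>i<m. if i \<in> I then ennreal (exp (- \<alpha> * real (n i))) else 0) \<le> t" .
  qed
  finally show "emeasure M D \<le> t" .
qed

text \<open>The threshold after which the ball estimate holds depends on the point, but some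
  \<open>D N0\<close> with a common threshold has positive measure. This measure bounds all late
  cover sums from below, so \<open>cover_measure\<close> cannot vanish for exponents below
  \<open>c\<close>.\<close>

lemma measure_entropy_scale_ge:
  assumes pos: "emeasure M {x \<in> space M. ereal c < scale_entropy (2 * \<epsilon>) x} > 0"
  shows "ereal c \<le> measure_entropy_scale M f \<epsilon>"
proof -
  define D where "D N = {x \<in> space M. \<forall>n\<ge>N. prob (dyn_ball f n x (2 * \<epsilon>)) \<le> exp (- c * real n)}" for N
  have D: "D N \<in> sets M" for N
    unfolding D_def by measurable
  have "{x \<in> space M. ereal c < scale_entropy (2 * \<epsilon>) x} \<subseteq> (\<Union>N. D N)"
  proof
    fix x assume "x \<in> {x \<in> space M. ereal c < scale_entropy (2 * \<epsilon>) x}"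
    then have "\<forall>\<^sub>F n in sequentially. prob (dyn_ball f n x (2 * \<epsilon>)) < exp (- c * real n)"
      by (intro less_scale_entropy_imp_eventually) simp
    then show "x \<in> (\<Union>N. D N)"
      unfolding eventually_sequentially D_def by (auto intro: less_imp_le)
  qed
  then have "emeasure M (\<Union>N. D N) > 0"
    using pos D by (meson emeasure_mono less_le_trans sets.countable_UN image_subsetI)
  then obtain N0 where N0: "emeasure M (D N0) > 0"
    using D by (metis emeasure_UN_eq_0 image_subsetI not_gr_zero)
  show ?thesis
    unfolding measure_entropy_scale_def
  proof (rule INF_greatest)
    fix Z assume "Z \<in> {Z \<in> sets M. emeasure M Z = 1}"
    then have Z: "Z \<in> sets M" "emeasure M Z = 1"
      by auto
    show "ereal c \<le> set_entropy_scale f Z \<epsilon>"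
      unfolding set_entropy_scale_def
    proof (rule Inf_greatest)
      fix a assume "a \<in> {ereal \<alpha> |\<alpha>. cover_measure f Z \<alpha> \<epsilon> = 0}"
      then obtain \<alpha> where \<alpha>: "a = ereal \<alpha>" "cover_measure f Z \<alpha> \<epsilon> = 0"
        by auto
      show "ereal c \<le> a"
      proof (rule ccontr)
        assume "\<not> ereal c \<le> a"
        then have "\<alpha> \<le> c"
          using \<alpha> by simp
        then have "emeasure M (D N0) \<le> cover_sum f Z \<alpha> N0 \<epsilon>"
          by (intro cover_sum_ge[OF Z _ order_refl D]) (auto simp: D_def)
        also have "\<dots> \<le> cover_measure f Z \<alpha> \<epsilon>"
          unfolding cover_measure_eq_SUP by (rule SUP_upper) simp
        finally show False
          using N0 \<alpha> by simp
      qed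
    qed
  qed
qed

text \<open>A level below the essential supremum is exceeded on a set of positive measure, hence
  also at one of the countably many scales. Half of that scale serves for the covers.\<close>

lemma measure_pressure_zero_ge: "esssup M (local_entropy M f) \<le> measure_pressure_zero M f"
proof (rule dense_le)
  fix y assume y: "y < esssup M (local_entropy M f)"
  show "y \<le> measure_pressure_zero M f"
  proof (cases y)
    case (real c)
    define A where "A k = {x \<in> space M. ereal c < scale_entropy (1 / real (Suc k)) x}" for k
    have A: "range A \<subseteq> sets M"
    proof (rule image_subsetI)
      show "A k \<in> sets M" for k
        unfolding A_def by measurable
    qed
    have "emeasure M {x \<in> space M. ereal c < local_entropy M f x} > 0"
      using y real by (intro esssup_pos_measure) auto
    also have "{x \<in> space M. ereal c < local_entropy M f x} = (\<Union>k. A k)"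
      by (auto simp: A_def local_entropy_eq_SUP_seq less_SUP_iff)
    finally obtain k where "emeasure M (A k) > 0"
      using emeasure_UN_eq_0[OF _ A] by (metis not_gr_zero)
    moreover have "2 * (1 / real (Suc k) / 2) = 1 / real (Suc k)"
      by (simp add: field_simps)
    ultimately have "ereal c \<le> measure_entropy_scale M f (1 / real (Suc k) / 2)"
      by (intro measure_entropy_scale_ge) (simp only: A_def)
    also have "\<dots> \<le> measure_pressure_zero M f"
      unfolding measure_pressure_zero_eq_SUP by (rule SUP_upper) simp
    finally show ?thesis
      using real by simp
  qed (use y in auto)
qed

theorem measure_pressure_zero_eq_esssup: "measure_pressure_zero M f = esssup M (local_entropy M f)"
  using measure_pressure_zero_le measure_pressure_zero_ge by (rule antisym)

end

section \<open>Inner approximation by closed sets\<close>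

text \<open>Regularity of finite Borel measures. Approximation from both sides at once is symmetric
  under complements, so induction over the sigma-algebra generated by the closed sets goes
  through.\<close>

lemma closed_open_approximation:
  fixes M :: "'a::metric_space measure"
  assumes "finite_measure M" and M: "sets M = sets borel" and "A \<in> sets M" "e > 0"
  shows "\<exists>C U. closed C \<and> open U \<and> C \<subseteq> A \<and> A \<subseteq> U \<and> measure M (U - C) < e"
proof -
  interpret finite_measure M by fact
  have closed_sets: "closed C \<Longrightarrow> C \<in> sets M" and open_sets: "open C \<Longrightarrow> C \<in> sets M" for C
    by (simp_all add: M)
  have "A \<in> sigma_sets UNIV (Collect closed)"
    using \<open>A \<in> sets M\<close> unfolding M by (subst (asm) borel_eq_closed) simp
  then show ?thesis
    using \<open>e > 0\<close>
  proof (induction arbitrary: e rule: sigma_sets.induct)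
    case (Basic A)
    then have A: "closed A" by simp
    show ?case
    \<comment> \<open>As \<open>infdist\<close> to the empty set is 0, the neighbourhoods
      \<open>U n\<close> would not shrink for empty \<open>A\<close>.\<close>
    proof (cases "A = {}")
      case True
      then show ?thesis
        using Basic.prems by (intro exI[of _ "{}"]) auto
    next
      case False
      define U where "U n = {x. infdist x A < 1 / real (Suc n)}" for n
      have U: "open (U n)" "A \<subseteq> U n" for n
        using False by (auto simp: U_def infdist_zero intro!: open_Collect_less continuous_intros)
      have "decseq U"
      proof (rule decseq_SucI, rule subsetI)
        fix n x assume "x \<in> U (Suc n)"
        moreover have "1 / real (Suc (Suc n)) \<le> 1 / real (Suc n)"
          by (intro divide_left_mono) auto
        ultimately show "x \<in> U n"
          unfolding U_def by simp
      qed
      then have "(\<lambda>n. measure M (U n)) \<longlonglongrightarrow> measure M (\<Inter>n. U n)"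
        using U(1) open_sets by (intro finite_Lim_measure_decseq) auto
      also have "(\<Inter>n. U n) = A"
      proof (intro equalityI subsetI)
        fix x assume x: "x \<in> (\<Inter>n. U n)"
        have "infdist x A \<le> 0"
        proof (rule field_le_epsilon)
          fix d :: real assume "d > 0"
          then obtain n where "1 / real (Suc n) < d"
            by (rule nat_approx_posE)
          moreover have "infdist x A < 1 / real (Suc n)"
            using x unfolding U_def by blast
          ultimately show "infdist x A \<le> 0 + d"
            by simp
        qed
        then show "x \<in> A"
          using A False infdist_nonneg[of x A] by (simp add: in_closed_iff_infdist_zero)
      qed (use U(2) in blast)
      finally have "\<forall>\<^sub>F n in sequentially. measure M (U n) < measure M A + e"
        using Basic.prems by (intro order_tendstoD(2)) auto
      then obtain n where "measure M (U n) < measure M A + e"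
        by (auto dest: eventually_happens)
      then have "measure M (U n - A) < e"
        using U A closed_sets open_sets by (subst finite_measure_Diff) auto
      then show ?thesis
        using U A by blast
    qed
  next
    case Empty
    then show ?case
      by (intro exI[of _ "{}"]) auto
  next
    case (Compl A)
    obtain C U where CU: "closed C" "open U" "C \<subseteq> A" "A \<subseteq> U" "measure M (U - C) < e"
      using Compl.IH[OF Compl.prems] by blast
    have "- C - - U = U - C"
      by blast
    then show ?case
      using CU by (intro exI[of _ "- U"] exI[of _ "- C"] conjI) auto
  next
    case (Union A)
    \<comment> \<open>These errors add up to \<open>e / 2\<close>; the other half is slack for the
      finite union below.\<close>
    have "\<exists>C U. closed C \<and> open U \<and> C \<subseteq> A i \<and> A i \<subseteq> U \<and> measure M (U - C) < e / 2 * (1 / 2) ^ Suc i" for i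
      using Union.prems by (intro Union.IH) auto
    then obtain C U where CU: "\<And>i. closed (C i)" "\<And>i. open (U i)" "\<And>i. C i \<subseteq> A i" "\<And>i. A i \<subseteq> U i"
      "\<And>i. measure M (U i - C i) < e / 2 * (1 / 2) ^ Suc i"
      by metis
    have sets: "U i \<in> sets M" "C i \<in> sets M" for i
      using CU closed_sets open_sets by auto
    \<comment> \<open>The union of all \<open>C i\<close> may fail to be closed; finite unions are
      closed and lose little measure by continuity from above.\<close>
    define F where "F m = (\<Union>i\<le>m. C i)" for m
    have F: "closed (F m)" for m
      unfolding F_def using CU by auto
    have sums: "(\<lambda>i. e / 2 * (1 / 2) ^ Suc i) sums (e / 2 * 1)"
      by (intro sums_mult power_half_series)
    have summ: "summable (\<lambda>i. measure M (U i - C i))"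
      using less_imp_le[OF CU(5)]
      by (intro summable_comparison_test'[OF sums_summable[OF sums], of 0]) auto
    have "decseq (\<lambda>m. (\<Union>i. U i) - F m)"
      by (rule decseq_SucI) (auto simp: F_def atMost_Suc)
    moreover have "range (\<lambda>m. (\<Union>i. U i) - F m) \<subseteq> sets M"
      using sets F closed_sets by auto
    ultimately have "(\<lambda>m. measure M ((\<Union>i. U i) - F m)) \<longlonglongrightarrow> measure M (\<Inter>m. (\<Union>i. U i) - F m)"
      by (intro finite_Lim_measure_decseq)
    moreover have "measure M (\<Inter>m. (\<Union>i. U i) - F m) < e"
    proof -
      have "measure M (\<Inter>m. (\<Union>i. U i) - F m) \<le> measure M (\<Union>i. U i - C i)"
      proof (rule finite_measure_mono)
        have "C i \<subseteq> F i" for i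
          by (auto simp: F_def)
        then show "(\<Inter>m. (\<Union>i. U i) - F m) \<subseteq> (\<Union>i. U i - C i)"
          by blast
      qed (use sets in auto)
      also have "\<dots> \<le> (\<Sum>i. measure M (U i - C i))"
        using sets by (intro finite_measure_subadditive_countably summ) auto
      also have "\<dots> \<le> (\<Sum>i. e / 2 * (1 / 2) ^ Suc i)"
        using less_imp_le[OF CU(5)] by (intro suminf_le summ sums_summable[OF sums]) auto
      also have "\<dots> < e"
        using sums Union.prems by (simp add: sums_iff)
      finally show ?thesis .
    qed
    ultimately have "\<forall>\<^sub>F m in sequentially. measure M ((\<Union>i. U i) - F m) < e"
      by (rule order_tendstoD(2))
    then obtain m where "measure M ((\<Union>i. U i) - F m) < e"
      by (auto dest: eventually_happens)
    moreover have "F m \<subseteq> (\<Union>i. A i)" "(\<Union>i. A i) \<subseteq> (\<Union>i. U i)"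
      using CU by (auto simp: F_def) blast+
    ultimately show ?case
      using F CU(2) by (intro exI[of _ "F m"] exI[of _ "\<Union>i. U i"] conjI) auto
  qed
qed

text \<open>The distance to \<open>T\<close> attains its minimum on \<open>S\<close>, and it is
  positive off the closed set \<open>T\<close>.\<close>

lemma separate_compact_closed_metric:
  fixes S T :: "'a::metric_space set"
  assumes S: "compact S" and T: "closed T" "S \<inter> T = {}"
  shows "\<exists>d>0. \<forall>x\<in>S. \<forall>y\<in>T. d \<le> dist x y"
proof (cases "S = {} \<or> T = {}")
  case True
  then show ?thesis
    by (auto intro: exI[of _ 1])
next
  case False
  have "continuous_on S (\<lambda>x. infdist x T)"
    by (intro continuous_intros)
  then obtain x where x: "x \<in> S" "\<And>y. y \<in> S \<Longrightarrow> infdist x T \<le> infdist y T"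
    using continuous_attains_inf[OF S, of "\<lambda>x. infdist x T"] False by blast
  have "infdist x T > 0"
    using x(1) T False in_closed_iff_infdist_zero[of T x] infdist_nonneg[of x T] by fastforce
  moreover have "infdist x T \<le> dist y z" if "y \<in> S" "z \<in> T" for y z
    using x(2)[OF that(1)] infdist_le[OF that(2), of y] by linarith
  ultimately show ?thesis
    by blast
qed

section \<open>Ergodicity\<close>

text \<open>The iterated preimages of \<open>A\<close> increase and all have the measure of
  \<open>A\<close>. Their union is strictly invariant and has the same measure.\<close>

lemma (in measure_preserving) subinvariant_prob_0_or_1:
  assumes erg: "\<And>A. A \<in> sets M \<Longrightarrow> f -` A \<inter> space M = A \<Longrightarrow> prob A = 0 \<or> prob A = 1"
    and A: "A \<in> sets M" "A \<subseteq> f -` A"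
  shows "prob A = 0 \<or> prob A = 1"
proof -
  define B where "B k = (f ^^ k) -` A \<inter> space M" for k
  have B: "B k \<in> sets M" "prob (B k) = prob A" for k
    using A(1) measure_distr[OF funpow_measurable A(1), of k] by (auto simp: B_def distr_funpow)
  have BS: "B k \<subseteq> B (Suc k)" for k
    using A(2) by (auto simp: B_def)
  have vim: "f -` B k \<inter> space M = B (Suc k)" for k
    using measurable_space[OF f_measurable] by (auto simp: B_def funpow_swap1)
  have "f -` (\<Union>k. B k) \<inter> space M = (\<Union>k. B (Suc k))"
    using vim by auto
  also have "\<dots> = (\<Union>k. B k)"
    using BS by blast
  finally have "prob (\<Union>k. B k) = 0 \<or> prob (\<Union>k. B k) = 1"
    using B(1) by (intro erg) auto
  moreover have "(\<lambda>k. prob (B k)) \<longlonglongrightarrow> prob (\<Union>k. B k)"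
    using B(1) BS by (intro finite_Lim_measure_incseq) (auto intro: incseq_SucI)
  then have "prob (\<Union>k. B k) = prob A"
    unfolding B(2) by (simp add: LIMSEQ_const_iff)
  ultimately show ?thesis
    by simp
qed

text \<open>Sublevel sets of \<open>g\<close> are mapped into themselves, so each has measure 0 or
  1, and measure 1 is impossible below the essential supremum.\<close>

lemma (in measure_preserving) AE_eq_esssup:
  fixes g :: "'a \<Rightarrow> ereal"
  assumes erg: "\<And>A. A \<in> sets M \<Longrightarrow> f -` A \<inter> space M = A \<Longrightarrow> prob A = 0 \<or> prob A = 1"
    and [measurable]: "g \<in> borel_measurable M" and g: "\<And>x. g (f x) \<le> g x"
  shows "AE x in M. g x = esssup M g"
proof -
  have less: "AE x in M. c < g x" if c: "c < esssup M g" for c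
  proof -
    let ?A = "{x \<in> space M. g x \<le> c}"
    have A: "?A \<in> sets M"
      by measurable
    have "?A \<subseteq> f -` ?A"
      using g measurable_space[OF f_measurable] by (auto intro: order_trans)
    from subinvariant_prob_0_or_1[OF erg A this] have "prob ?A = 0 \<or> prob ?A = 1" .
    moreover have "prob ?A \<noteq> 1"
    proof
      assume "prob ?A = 1"
      then have "AE x in M. g x \<le> c"
        using A by (auto dest: AE_prob_1)
      then have "esssup M g \<le> c"
        by (intro esssup_I) auto
      then show False
        using c by simp
    qed
    ultimately have "AE x in M. x \<notin> ?A"
      using A prob_eq_0 by blast
    then show ?thesis
      by (rule AE_mp) (auto simp: not_le)
  qed
  \<comment> \<open>Rational levels keep the number of null sets countable.\<close>
  have "AE x in M. \<forall>q::rat. ereal (of_rat q) < esssup M g \<longrightarrow> ereal (of_rat q) < g x"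
    using less by (auto simp: AE_all_countable)
  then show ?thesis
    using esssup_AE[of g M]
  proof eventually_elim
    case (elim x)
    show ?case
    proof (rule antisym)
      show "esssup M g \<le> g x"
      proof (rule ccontr)
        assume "\<not> esssup M g \<le> g x"
        then obtain r where r: "g x < ereal r" "ereal r < esssup M g"
          using ereal_dense2 not_le by metis
        obtain r' where r': "ereal r < ereal r'" "ereal r' < esssup M g"
          using ereal_dense2[OF r(2)] by blast
        then obtain q :: rat where q: "r < of_rat q" "of_rat q < r'"
          using of_rat_dense[of r r'] by auto
        have "ereal (of_rat q) < esssup M g"
          using q(2) r'(2) by (meson less_ereal.simps(1) less_trans)
        then have "ereal (of_rat q) < g x"
          using elim(1) by blast
        also note r(1)
        finally show False
          using q(1) by simp
      qed
    qed (use elim in auto)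
  qed
qed

section \<open>Kolmogorov--Sinai entropy and local entropy\<close>

context topological_system
begin

text \<open>The atom of a point lies in its dynamical ball because of the small diameters. Hence the
  information is at least \<open>c * n\<close> on \<open>D n\<close>, and the measure of
  \<open>D n\<close> tends to 1.\<close>

lemma partition_entropy_rate_ge:
  assumes P: "P \<in> finite_measurable_partitions M"
    and diam: "\<And>A x y. A \<in> P \<Longrightarrow> x \<in> A \<Longrightarrow> y \<in> A \<Longrightarrow> dist x y < \<epsilon>"
    and c: "AE x in M. ereal c < scale_entropy \<epsilon> x"
  shows "c \<le> partition_entropy_rate M f P"
proof -
  interpret measure_preserving_partition M f P
    by unfold_locales (rule P)
  define D where "D n = {x \<in> space M. prob (dyn_ball f n x \<epsilon>) \<le> exp (- c * real n)}" for n
  have D: "D n \<in> sets M" for n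
    unfolding D_def by measurable
  define F where "F N = (\<Inter>n\<in>{N..}. D n)" for N
  have F: "F N \<in> sets M" for N
    unfolding F_def using D by (intro sets.countable_INT') auto
  have "incseq F"
    unfolding incseq_def F_def by (intro allI impI INF_superset_mono) auto
  then have "(\<lambda>N. prob (F N)) \<longlonglongrightarrow> prob (\<Union>N. F N)"
    using F by (intro finite_Lim_measure_incseq) auto
  also have "prob (\<Union>N. F N) = 1"
  proof (rule prob_eq_1[THEN iffD2])
    show "AE x in M. x \<in> (\<Union>N. F N)"
      using c
    proof eventually_elim
      case (elim x)
      then show ?case
        using less_scale_entropy_imp_eventually[OF elim]
        by (auto simp: F_def D_def eventually_sequentially intro: less_imp_le)
    qed
  qed (use F in auto)
  finally have F1: "(\<lambda>N. prob (F N)) \<longlonglongrightarrow> 1" .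
  have "(\<lambda>N. prob (D N)) \<longlonglongrightarrow> 1"
  proof (rule tendsto_sandwich[OF _ _ F1 tendsto_const])
    show "\<forall>\<^sub>F N in sequentially. prob (F N) \<le> prob (D N)"
      using D by (intro always_eventually allI finite_measure_mono) (auto simp: F_def)
  qed auto
  then have "(\<lambda>n. c * prob (D n)) \<longlonglongrightarrow> c * 1"
    by (intro tendsto_intros)
  moreover have "\<forall>\<^sub>F n in sequentially. c * prob (D n) \<le> word_entropy n / real n"
    using eventually_gt_at_top[of 0]
  proof eventually_elim
    case (elim n)
    have sub: "cylinder w \<subseteq> dyn_ball f n x \<epsilon>" if w: "w \<in> words P n" and x: "x \<in> cylinder w" for w x
    proof
      fix y assume y: "y \<in> cylinder w"
      have "dist ((f ^^ i) x) ((f ^^ i) y) < \<epsilon>" if "i < n" for i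
      proof (rule diam)
        show "w ! i \<in> P"
          using w that by (auto simp: words_def)
        show "(f ^^ i) x \<in> w ! i" "(f ^^ i) y \<in> w ! i"
          using x y that by (auto simp: cylinder_eq[OF w])
      qed
      then show "y \<in> dyn_ball f n x \<epsilon>"
        by (simp add: dyn_ball_def)
    qed
    \<comment> \<open>Only the part of the atom inside \<open>D n\<close> is counted, so atoms that
      miss \<open>D n\<close> need just a nonnegative right-hand side.\<close>
    have atom_le: "prob (cylinder w \<inter> D n) * (c * real n) \<le> prob (cylinder w) * - ln (prob (cylinder w))"
      if w: "w \<in> words P n" for w
    proof (cases "prob (cylinder w \<inter> D n) = 0")
      case True
      then show ?thesis
        by (cases "prob (cylinder w) = 0")
           (auto simp: mult_nonneg_nonpos zero_less_measure_iff)
    next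
      case False
      then obtain x where x: "x \<in> cylinder w" "x \<in> D n"
        by (metis IntE all_not_in_conv measure_empty)
      have le: "prob (cylinder w \<inter> D n) \<le> prob (cylinder w)"
        using cylinder_sets[OF w] by (intro finite_measure_mono) auto
      then have pos: "prob (cylinder w) > 0"
        using False measure_nonneg[of M "cylinder w \<inter> D n"] by linarith
      have "prob (cylinder w) \<le> prob (dyn_ball f n x \<epsilon>)"
        using sub[OF w x(1)] by (intro finite_measure_mono) auto
      also have "\<dots> \<le> exp (- c * real n)"
        using x(2) by (simp add: D_def)
      finally have "ln (prob (cylinder w)) \<le> - c * real n"
        using pos by (metis exp_ge_zero ln_exp ln_mono)
      then have cn: "c * real n \<le> - ln (prob (cylinder w))"
        by simp
      have "prob (cylinder w \<inter> D n) * (c * real n) \<le> prob (cylinder w \<inter> D n) * - ln (prob (cylinder w))"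
        by (intro mult_left_mono cn) simp
      also have "\<dots> \<le> prob (cylinder w) * - ln (prob (cylinder w))"
        using pos by (intro mult_right_mono le) simp
      finally show ?thesis .
    qed
    have "prob (D n) = (\<Sum>w\<in>words P n. prob (cylinder w \<inter> D n))"
    proof -
      have "D n = (\<Union>w\<in>words P n. cylinder w \<inter> D n)"
      proof (intro equalityI subsetI)
        fix x assume "x \<in> D n"
        then show "x \<in> (\<Union>w\<in>words P n. cylinder w \<inter> D n)"
          using word_in_words[of x n] in_cylinder_word[of x n] by auto
      qed auto
      then have "prob (D n) = prob (\<Union>w\<in>words P n. cylinder w \<inter> D n)"
        by simp
      also have "\<dots> = (\<Sum>w\<in>words P n. prob (cylinder w \<inter> D n))"
      proof (rule finite_measure_finite_Union)
        show "finite (words P n)"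
          by (rule finite_words[OF finite_P])
        show "(\<lambda>w. cylinder w \<inter> D n) ` words P n \<subseteq> events"
          using D cylinder_sets by blast
      qed (auto simp: disjoint_family_on_def cylinder_def words_def)
      finally show ?thesis .
    qed
    then have "prob (D n) * (c * real n) = (\<Sum>w\<in>words P n. prob (cylinder w \<inter> D n) * (c * real n))"
      by (simp add: sum_distrib_right)
    also have "\<dots> \<le> (\<Sum>w\<in>words P n. prob (cylinder w) * - ln (prob (cylinder w)))"
      by (intro sum_mono atom_le)
    also have "\<dots> = word_entropy n"
      by (simp add: word_entropy_def sum_negf)
    finally show ?case
      using elim by (simp add: field_simps)
  qed
  ultimately have "c * 1 \<le> partition_entropy_rate M f P"
    using word_entropy_rate by (intro tendsto_le[OF sequentially_bot])
  then show ?thesis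
    by simp
qed

end

section \<open>Partitions of small diameter and separated compact sets\<close>

lemma borel_partition_small_diameter:
  assumes "compact (UNIV :: 'a::metric_space set)" "\<epsilon> > 0"
  shows "\<exists>P :: 'a set set. finite P \<and> partition_on UNIV P \<and> P \<subseteq> sets borel \<and>
     (\<forall>A\<in>P. \<forall>x\<in>A. \<forall>y\<in>A. dist x y < \<epsilon>)"
proof -
  have "UNIV \<subseteq> (\<Union>x::'a. ball x (\<epsilon> / 2))"
    using assms(2) by auto
  then obtain S :: "'a set" where S: "finite S" "UNIV \<subseteq> (\<Union>x\<in>S. ball x (\<epsilon> / 2))"
    using compactE_image[OF assms(1), of UNIV "\<lambda>x. ball x (\<epsilon> / 2)"] by auto
  obtain xs where xs: "set xs = S"
    using finite_list[OF S(1)] by blast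
  define B where "B i = ball (xs ! i) (\<epsilon> / 2)" for i
  define P where "P = disjointed B ` {..<length xs} - {{}}"
  have B: "\<exists>i<length xs. x \<in> B i" for x
  proof -
    obtain z where "z \<in> set xs" "x \<in> ball z (\<epsilon> / 2)"
      using S(2) xs by blast
    then show ?thesis
      by (auto simp: B_def in_set_conv_nth)
  qed
  have cover: "\<exists>i<length xs. x \<in> disjointed B i" for x
  proof -
    \<comment> \<open>The first ball that contains \<open>x\<close> keeps it when the balls are made
      disjoint.\<close>
    define i where "i = (LEAST i. x \<in> B i)"
    have "x \<in> B i" "i < length xs"
      unfolding i_def using B[of x] by (auto intro: LeastI Least_le le_less_trans)
    moreover have "x \<notin> B j" if "j < i" for j
      using not_less_Least that unfolding i_def by blast
    ultimately show ?thesis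
      by (auto simp: disjointed_def)
  qed
  show ?thesis
  proof (intro exI[of _ P] conjI ballI)
    show "partition_on UNIV P"
    proof (rule partition_onI)
      show "\<Union> P = UNIV"
        using cover by (fastforce simp: P_def)
      show "disjnt p q" if "p \<in> P" "q \<in> P" "p \<noteq> q" for p q
      proof -
        obtain i j where "p = disjointed B i" "q = disjointed B j"
          using \<open>p \<in> P\<close> \<open>q \<in> P\<close> unfolding P_def by blast
        then show ?thesis
          using \<open>p \<noteq> q\<close> disjoint_family_onD[OF disjoint_family_disjointed[of B], of i j]
          by (auto simp: disjnt_def)
      qed
    qed (simp add: P_def)
    show "P \<subseteq> sets borel"
    proof -
      have "range B \<subseteq> sets borel"
        by (auto simp: B_def)
      then have "range (disjointed B) \<subseteq> sets borel"
        by (rule sets.range_disjointed_sets)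
      then show ?thesis
        by (auto simp: P_def)
    qed
    show "dist x y < \<epsilon>" if "A \<in> P" "x \<in> A" "y \<in> A" for A x y
    proof -
      obtain i where "x \<in> B i" "y \<in> B i"
        using \<open>A \<in> P\<close> \<open>x \<in> A\<close> \<open>y \<in> A\<close> disjointed_subset[of B] unfolding P_def by blast
      then show ?thesis
        using dist_triangle_half_r[of "xs ! i" x \<epsilon> y] by (simp add: B_def)
    qed
  qed (simp add: P_def)
qed

lemma separate_finite_compact:
  fixes C :: "'i \<Rightarrow> 'a::metric_space set"
  assumes I: "finite I" and C: "\<And>i. i \<in> I \<Longrightarrow> compact (C i)"
    and disj: "\<And>i j. i \<in> I \<Longrightarrow> j \<in> I \<Longrightarrow> i \<noteq> j \<Longrightarrow> C i \<inter> C j = {}"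
  shows "\<exists>d>0. \<forall>i\<in>I. \<forall>j\<in>I. i \<noteq> j \<longrightarrow> (\<forall>x\<in>C i. \<forall>y\<in>C j. d \<le> dist x y)"
proof -
  have "\<exists>d>0. i \<in> I \<longrightarrow> j \<in> I \<longrightarrow> i \<noteq> j \<longrightarrow> (\<forall>x\<in>C i. \<forall>y\<in>C j. d \<le> dist x y)" for i j
  proof (cases "i \<in> I \<and> j \<in> I \<and> i \<noteq> j")
    case True
    then show ?thesis
      using separate_compact_closed_metric[of "C i" "C j"] C disj compact_imp_closed by blast
  qed (auto intro: exI[of _ 1])
  then obtain d where d: "\<And>i j. d i j > (0::real)"
    "\<And>i j. i \<in> I \<Longrightarrow> j \<in> I \<Longrightarrow> i \<noteq> j \<Longrightarrow> \<forall>x\<in>C i. \<forall>y\<in>C j. d i j \<le> dist x y"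
    by metis
  \<comment> \<open>The element 1 keeps the minimum defined when \<open>I\<close> is empty.\<close>
  define D where "D = insert 1 ((\<lambda>(i, j). d i j) ` (I \<times> I))"
  have D: "finite D"
    using I by (simp add: D_def)
  have "Min D > 0"
    using D d(1) by (subst Min_gr_iff) (auto simp: D_def)
  moreover have "Min D \<le> dist x y" if "i \<in> I" "j \<in> I" "i \<noteq> j" "x \<in> C i" "y \<in> C j" for i j x y
  proof -
    have "Min D \<le> d i j"
      using D that by (intro Min_le) (auto simp: D_def)
    also have "\<dots> \<le> dist x y"
      using d(2) that by blast
    finally show ?thesis .
  qed
  ultimately show ?thesis
    by blast
qed

section \<open>Entropy of arbitrary partitions and the two comparisons with the essential
  supremum\<close>

context topological_system
begin

text \<open>Blocks of the code are pairs of a length \<open>n\<close> in \<open>{m..K}\<close> and a centre \<open>z\<close> of a dynamical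
  ball of radius \<open>2 * \<epsilon>\<close>. A point of that ball is assigned the cell of the nearby compact set,
  which is correct except at the times its orbit visits \<open>V\<close>.\<close>

lemma partition_entropy_rate_le_scale:
  assumes cpt: "compact (UNIV :: 'a set)"
    and P: "P \<in> finite_measurable_partitions M"
    and s: "s < s'" "0 \<le> s'"
    and freq: "\<And>\<epsilon>. \<epsilon> > 0 \<Longrightarrow>
       AE x in M. \<exists>\<^sub>F n in sequentially. exp (- s * real n) \<le> prob (dyn_ball f n x \<epsilon>)"
    and \<eta>: "\<eta> > 0"
  shows "partition_entropy_rate M f P \<le> s' + 3 * \<eta>"
proof -
  interpret measure_preserving_partition M f P
    by unfold_locales (rule P)
  define k where "k = real (card P)"
  \<comment> \<open>In the letter weights \<open>wt\<close> below, \<open>\<gamma>\<close> is spread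
    evenly over all symbols and \<open>1 - \<gamma> = exp (- \<eta>)\<close> goes to the predicted
    one. A right prediction thus costs at most \<open>\<eta>\<close>, a wrong one
    \<open>l\<close>.\<close>
  define \<gamma> where "\<gamma> = 1 - exp (- \<eta>)"
  define l where "l = ln (k / \<gamma>)"
  have k: "k \<ge> 1"
    using card_P_pos by (simp add: k_def)
  have \<gamma>: "0 < \<gamma>" "\<gamma> < 1"
    using \<eta> by (auto simp: \<gamma>_def)
  then have l: "l \<ge> 0"
    unfolding l_def using k by (intro ln_ge_zero) (simp add: field_simps)
  have exp_l: "exp (- l) = \<gamma> / k"
    using k \<gamma> by (simp add: l_def exp_minus)
  \<comment> \<open>Chosen so that the visits to \<open>V\<close> cost at most \<open>\<eta>\<close>
    on average; \<open>l + 1\<close> avoids a division by 0.\<close>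
  define \<delta> where "\<delta> = \<eta> / (l + 1)"
  have \<delta>: "\<delta> > 0" "l * \<delta> \<le> \<eta>"
    using l \<eta> by (auto simp: \<delta>_def field_simps)

  have "\<exists>C. closed C \<and> C \<subseteq> A \<and> prob (A - C) < \<delta> / k" if A: "A \<in> P" for A
  proof -
    obtain C U where CU: "closed C" "open U" "C \<subseteq> A" "A \<subseteq> U" "prob (U - C) < \<delta> / k"
      using closed_open_approximation[OF finite_measure_axioms sets_M P_sets[OF A], of "\<delta> / k"] \<delta> k by auto
    have "prob (A - C) \<le> prob (U - C)"
      using CU by (intro finite_measure_mono) (auto simp: sets_M)
    then show ?thesis
      using CU by auto
  qed
  then obtain C where C: "\<And>A. A \<in> P \<Longrightarrow> closed (C A)" "\<And>A. A \<in> P \<Longrightarrow> C A \<subseteq> A"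
    "\<And>A. A \<in> P \<Longrightarrow> prob (A - C A) < \<delta> / k"
    by metis
  have compact_C: "compact (C A)" if "A \<in> P" for A
    using compact_Int_closed[OF cpt C(1)[OF that]] by simp
  have C_sets: "C A \<in> sets M" if "A \<in> P" for A
    using C(1)[OF that] by (simp add: sets_M)
  define V where "V = UNIV - (\<Union>A\<in>P. C A)"
  have V: "V \<in> sets M"
    unfolding V_def using C_sets finite_P by (metis sets.Diff sets.finite_UN sets.top space_M)
  have prob_V: "l * prob V \<le> \<eta>"
  proof -
    have "V \<subseteq> (\<Union>A\<in>P. A - C A)"
      using partition_onD1[OF partition_P] by (auto simp: V_def)
    then have "prob V \<le> prob (\<Union>A\<in>P. A - C A)"
      using C_sets P_sets finite_P by (intro finite_measure_mono) auto
    also have "\<dots> \<le> (\<Sum>A\<in>P. prob (A - C A))"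
      using C_sets P_sets finite_P by (intro finite_measure_subadditive_finite) auto
    also have "\<dots> \<le> (\<Sum>A\<in>P. \<delta> / k)"
      using C(3) by (intro sum_mono less_imp_le)
    also have "\<dots> = \<delta>"
      using k by (simp add: k_def)
    finally have "l * prob V \<le> l * \<delta>"
      using l by (intro mult_left_mono)
    then show ?thesis
      using \<delta> by simp
  qed

  have "\<exists>d>0. \<forall>A\<in>P. \<forall>B\<in>P. A \<noteq> B \<longrightarrow> (\<forall>x\<in>C A. \<forall>y\<in>C B. d \<le> dist x y)"
  proof (rule separate_finite_compact[OF finite_P compact_C])
    show "C A \<inter> C B = {}" if "A \<in> P" "B \<in> P" "A \<noteq> B" for A B
      using C(2)[OF that(1)] C(2)[OF that(2)] disjointD[OF partition_onD2[OF partition_P] that] by blast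
  qed
  then obtain d where "d > 0"
    and "\<forall>A\<in>P. \<forall>B\<in>P. A \<noteq> B \<longrightarrow> (\<forall>x\<in>C A. \<forall>y\<in>C B. d \<le> dist x y)"
    by (elim exE conjE) (rule that)
  note d = this(1) this(2)[rule_format]
  \<comment> \<open>Two points within \<open>2 * \<epsilon>\<close> of \<open>u\<close> are less
    than \<open>d\<close> apart, so at most one of the compact sets comes that close to
    \<open>u\<close>.\<close>
  define \<epsilon> where "\<epsilon> = d / 4"
  have \<epsilon>: "\<epsilon> > 0"
    using d by (simp add: \<epsilon>_def)
  define c where "c u = (SOME A. A \<in> P \<and> (\<exists>y\<in>C A. dist u y < 2 * \<epsilon>))" for u
  have c: "c u = cell y" if "y \<notin> V" "dist u y < 2 * \<epsilon>" for u y
  proof -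
    obtain A where A: "A \<in> P" "y \<in> C A"
      using \<open>y \<notin> V\<close> by (auto simp: V_def)
    have "B = A" if B: "B \<in> P \<and> (\<exists>y\<in>C B. dist u y < 2 * \<epsilon>)" for B
    proof (rule ccontr)
      assume "B \<noteq> A"
      moreover obtain y' where y': "y' \<in> C B" "dist u y' < 2 * \<epsilon>"
        using B by blast
      ultimately have "d \<le> dist y' y"
        using B A by (intro d(2)) auto
      also have "\<dots> < d"
        using y' \<open>dist u y < 2 * \<epsilon>\<close> dist_triangle3[of y' y u] by (simp add: \<epsilon>_def)
      finally show False by simp
    qed
    then have "c u = A"
      unfolding c_def using A that by (intro some_equality) auto
    also have "A = cell y"
      using A C(2) by (intro cell_eq[symmetric]) auto
    finally show ?thesis .
  qed

  obtain E where E: "\<And>n. finite (E n)" "\<And>n. real (card (E n)) \<le> exp (s * real n)"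
    "\<And>n. {x. exp (- s * real n) \<le> prob (dyn_ball f n x \<epsilon>)} \<subseteq> (\<Union>z\<in>E n. dyn_ball f n z (2 * \<epsilon>))"
    using separated_cover[OF \<epsilon>, of s] by metis
  define wt where "wt u a = (if a = c u then 1 - \<gamma> else 0) + \<gamma> / k" for u a
  have wt_nonneg: "wt u a \<ge> 0" for u a
    using \<gamma> k by (simp add: wt_def)
  have wt_sum: "(\<Sum>a\<in>P. wt u a) \<le> 1" for u
    using \<gamma> k finite_P by (simp add: wt_def sum.distrib k_def)
  have wt_ge: "exp (- (\<eta> + l * indicator V y)) \<le> wt u (cell y)" if "dist u y < 2 * \<epsilon>" for u y
  proof (cases "y \<in> V")
    case True
    have "exp (- (\<eta> + l)) \<le> exp (- l)"
      using \<eta> by simp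
    also have "\<dots> \<le> wt u (cell y)"
      using \<gamma> by (simp add: wt_def exp_l)
    finally show ?thesis
      using True by simp
  next
    case False
    then show ?thesis
      using c[OF False that] \<gamma> k by (simp add: wt_def \<gamma>_def)
  qed
  \<comment> \<open>A sum over centres, so that any single centre gives a lower bound. The factor
    with rate \<open>s'\<close> outweighs the at most \<open>exp (s * n)\<close> centres and leaves
    a total of \<open>q ^ n\<close>.\<close>
  define r where "r w = exp (- s' * real (length w)) *
    (\<Sum>z\<in>E (length w). \<Prod>j<length w. wt ((f ^^ j) z) (w ! j))" for w
  have r_nonneg: "r w \<ge> 0" for w
    unfolding r_def by (intro mult_nonneg_nonneg sum_nonneg prod_nonneg wt_nonneg) auto
  define q where "q = exp (- (s' - s))"
  have q: "0 \<le> q" "q < 1"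
    using s by (auto simp: q_def)
  have r_sum: "(\<Sum>w\<in>words P n. r w) \<le> q ^ n" for n
  proof -
    have "(\<Sum>w\<in>words P n. r w)
        = (\<Sum>w\<in>words P n. exp (- s' * real n) * (\<Sum>z\<in>E n. \<Prod>j<n. wt ((f ^^ j) z) (w ! j)))"
      by (intro sum.cong) (auto simp: r_def words_def)
    also have "\<dots> = exp (- s' * real n) * (\<Sum>z\<in>E n. \<Sum>w\<in>words P n. \<Prod>j<n. wt ((f ^^ j) z) (w ! j))"
      unfolding sum_distrib_left[symmetric] by (subst sum.swap) (rule refl)
    also have "\<dots> \<le> exp (- s' * real n) * (\<Sum>z\<in>E n. 1)"
      by (intro mult_left_mono sum_mono sum_words_prod_le_1 wt_nonneg wt_sum) auto
    also have "\<dots> \<le> exp (- s' * real n) * exp (s * real n)"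
      using E(2)[of n] by (intro mult_left_mono) auto
    also have "\<dots> = q ^ n"
      by (simp add: q_def exp_add[symmetric] exp_of_nat_mult[symmetric] algebra_simps)
    finally show ?thesis .
  qed

  \<comment> \<open>Blocks are at least \<open>m\<close> long, which brings their total weight under
    the \<open>1 / 2\<close> that the code allows.\<close>
  obtain m where m: "m \<ge> 1" "q ^ m / (1 - q) \<le> 1 / 2"
  proof -
    have "(\<lambda>m. q ^ m / (1 - q)) \<longlonglongrightarrow> 0 / (1 - q)"
      using q by (intro tendsto_intros LIMSEQ_power_zero) auto
    then have "\<forall>\<^sub>F m in sequentially. q ^ m / (1 - q) < 1 / 2"
      by (rule order_tendstoD(2)) simp
    then obtain m0 where m0: "\<And>m. m \<ge> m0 \<Longrightarrow> q ^ m / (1 - q) < 1 / 2"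
      unfolding eventually_sequentially by blast
    show thesis
      by (rule that[OF max.cobounded2 less_imp_le[OF m0[OF max.cobounded1]]])
  qed
  \<comment> \<open>At these points no block of length at most \<open>K\<close> is available. They
    decrease to a null set as \<open>K\<close> grows, so spelling out their symbols costs at most
    \<open>\<eta>\<close> on average for large \<open>K\<close>.\<close>
  define Bad where "Bad K = {x \<in> space M. \<forall>n\<in>{m..K}. \<not> exp (- s * real n) \<le> prob (dyn_ball f n x \<epsilon>)}" for K
  have Bad: "Bad K \<in> sets M" for K
    unfolding Bad_def by measurable
  obtain K where K: "ln (2 * k) * prob (Bad K) \<le> \<eta>"
  proof -
    have "decseq Bad"
      unfolding decseq_def Bad_def by auto
    then have "(\<lambda>K. prob (Bad K)) \<longlonglongrightarrow> prob (\<Inter>K. Bad K)"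
      using Bad by (intro finite_Lim_measure_decseq) auto
    also have "prob (\<Inter>K. Bad K) = 0"
    proof (rule prob_eq_0[THEN iffD2])
      show "AE x in M. x \<notin> (\<Inter>K. Bad K)"
        using freq[OF \<epsilon>]
      proof eventually_elim
        case (elim x)
        then obtain n where "n \<ge> m" "exp (- s * real n) \<le> prob (dyn_ball f n x \<epsilon>)"
          unfolding frequently_sequentially by blast
        then have "x \<notin> Bad n"
          unfolding Bad_def by auto
        then show ?case
          by blast
      qed
    qed (use Bad in auto)
    finally have "(\<lambda>K. ln (2 * k) * prob (Bad K)) \<longlonglongrightarrow> ln (2 * k) * 0"
      by (intro tendsto_intros)
    then have "\<forall>\<^sub>F K in sequentially. ln (2 * k) * prob (Bad K) < \<eta>"
      using \<eta> by (intro order_tendstoD(2)) auto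
    then obtain K where "ln (2 * k) * prob (Bad K) < \<eta>"
      by (auto dest: eventually_happens)
    then show thesis
      by (intro that[of K]) simp
  qed

  \<comment> \<open>Cost per unit of time: block rate and right predictions everywhere, wrong
    predictions on \<open>V\<close>, and spelled letters on \<open>Bad K\<close>.\<close>
  define \<phi> where "\<phi> x = (s' + \<eta>) + l * indicator V x + ln (2 * k) * indicator (Bad K) x" for x
  have lk: "ln (2 * k) \<ge> 0"
    using k by simp
  have ind: "integrable M (indicator A :: 'a \<Rightarrow> real)" if "A \<in> sets M" for A
    using that by (simp add: integrable_indicator_iff emeasure_eq_measure)
  have \<phi>_int: "integrable M \<phi>"
    unfolding \<phi>_def using V Bad
    by (intro Bochner_Integration.integrable_add integrable_const integrable_mult_right ind) auto
  have "partition_entropy_rate M f P \<le> (\<integral>x. \<phi> x \<partial>M)"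
  proof (rule partition_entropy_rate_le[of r "{m..K}" K])
    have "(\<Sum>n\<in>{m..K}. \<Sum>v\<in>words P n. r v) \<le> (\<Sum>n\<in>{m..<Suc K}. q ^ n)"
      unfolding atLeastLessThanSuc_atLeastAtMost by (intro sum_mono r_sum)
    also have "\<dots> \<le> 1 / 2"
      using sum_power_le_geometric_tail[OF q, of m "Suc K"] m by linarith
    finally show "(\<Sum>n\<in>{m..K}. \<Sum>v\<in>words P n. r v) \<le> 1 / 2" .
    show "\<phi> x \<ge> 0" for x
      unfolding \<phi>_def using s \<eta> l lk by (intro add_nonneg_nonneg mult_nonneg_nonneg) auto
    show "ln (2 * real (card P)) \<le> \<phi> x \<or>
      (\<exists>n\<in>{m..K}. r (word n x) > 0 \<and> - ln (r (word n x)) \<le> (\<Sum>j<n. \<phi> ((f ^^ j) x)))" for x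
    proof (cases "x \<in> Bad K")
      case True
      then have "\<phi> x = (s' + \<eta>) + l * indicator V x + ln (2 * k)"
        by (simp add: \<phi>_def)
      moreover have "(s' + \<eta>) + l * indicator V x \<ge> 0"
        using s \<eta> l by (intro add_nonneg_nonneg mult_nonneg_nonneg) auto
      ultimately show ?thesis
        by (simp add: k_def)
    next
      case False
      then obtain n where n: "n \<in> {m..K}" "exp (- s * real n) \<le> prob (dyn_ball f n x \<epsilon>)"
        by (auto simp: Bad_def)
      then obtain z where z: "z \<in> E n" "x \<in> dyn_ball f n z (2 * \<epsilon>)"
        using E(3) by blast
      have "exp (- (\<Sum>j<n. \<phi> ((f ^^ j) x))) \<le> exp (- (\<Sum>j<n. s' + (\<eta> + l * indicator V ((f ^^ j) x))))"
        unfolding exp_le_cancel_iff neg_le_iff_le \<phi>_def using lk by (intro sum_mono) simp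
      also have "\<dots> = exp (- s' * real n) * (\<Prod>j<n. exp (- (\<eta> + l * indicator V ((f ^^ j) x))))"
        by (simp add: exp_sum[symmetric] exp_add[symmetric] sum.distrib sum_negf sum_subtractf mult.commute)
      also have "\<dots> \<le> exp (- s' * real n) * (\<Prod>j<n. wt ((f ^^ j) z) (cell ((f ^^ j) x)))"
      proof (intro mult_left_mono prod_mono conjI)
        fix j assume "j \<in> {..<n}"
        then show "exp (- (\<eta> + l * indicator V ((f ^^ j) x))) \<le> wt ((f ^^ j) z) (cell ((f ^^ j) x))"
          using z(2) by (intro wt_ge) (auto simp: dyn_ball_def)
      qed auto
      \<comment> \<open>The product for the one centre near \<open>x\<close> is a summand of
        \<open>r\<close>.\<close>
      also have "\<dots> \<le> exp (- s' * real n) * (\<Sum>z\<in>E n. \<Prod>j<n. wt ((f ^^ j) z) (cell ((f ^^ j) x)))"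
        using E(1) z(1) wt_nonneg
        by (intro mult_left_mono member_le_sum[of z "E n" "\<lambda>z. \<Prod>j<n. wt ((f ^^ j) z) (cell ((f ^^ j) x))"])
           (auto intro: prod_nonneg)
      also have "\<dots> = r (word n x)"
        unfolding r_def by simp
      finally have le: "exp (- (\<Sum>j<n. \<phi> ((f ^^ j) x))) \<le> r (word n x)" .
      then have pos: "r (word n x) > 0"
        using exp_gt_zero less_le_trans by blast
      have "- ln (r (word n x)) \<le> (\<Sum>j<n. \<phi> ((f ^^ j) x))"
        using le ln_ge_iff[OF pos, of "- (\<Sum>j<n. \<phi> ((f ^^ j) x))"] by linarith
      then show ?thesis
        using n pos by blast
    qed
  qed (use m r_nonneg \<phi>_int in auto)
  also have "\<dots> = (s' + \<eta>) + l * prob V + ln (2 * k) * prob (Bad K)"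
    unfolding \<phi>_def using V Bad ind prob_space by simp
  also have "\<dots> \<le> s' + 3 * \<eta>"
    using prob_V K by simp
  finally show ?thesis .
qed

text \<open>Any real \<open>s\<close> above the essential supremum serves as the rate at every
  scale, for almost every point.\<close>

lemma ks_entropy_le_esssup:
  assumes cpt: "compact (UNIV :: 'a set)"
  shows "ks_entropy M f \<le> esssup M (local_entropy M f)"
  unfolding ks_entropy_def
proof (rule SUP_least, rule ereal_le_via_reals)
  fix P s' assume P: "P \<in> finite_measurable_partitions M" and "esssup M (local_entropy M f) < ereal s'"
  then obtain s where s: "esssup M (local_entropy M f) < ereal s" "s < s'"
    using ereal_dense2 by force
  have freq: "AE x in M. \<exists>\<^sub>F n in sequentially. exp (- s * real n) \<le> prob (dyn_ball f n x \<epsilon>)"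
    if "\<epsilon> > 0" for \<epsilon>
    using esssup_AE[of "local_entropy M f" M]
  proof eventually_elim
    case (elim x)
    then have "scale_entropy \<epsilon> x < ereal s"
      using scale_entropy_le_local_entropy[OF that, of x] s(1) by auto
    then show ?case
      by (rule scale_entropy_less_imp_frequently)
  qed
  \<comment> \<open>One point and one \<open>n \<ge> 1\<close> already force
    \<open>0 \<le> s\<close>, as probabilities are at most 1.\<close>
  have "\<exists>x. \<exists>\<^sub>F n in sequentially. exp (- s * real n) \<le> prob (dyn_ball f n x 1)"
    using eventually_happens[OF freq[of 1]] by (simp add: ae_filter_eq_bot_iff emeasure_space_1[simplified])
  then obtain x n where n: "n \<ge> 1" "exp (- s * real n) \<le> prob (dyn_ball f n x 1)"
    unfolding frequently_sequentially by blast
  then have "exp (- s * real n) \<le> exp 0"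
    using order_trans[OF n(2) prob_le_1] by simp
  then have "0 \<le> s"
    using n(1) by (simp add: zero_le_mult_iff)
  then have s': "0 \<le> s'"
    using s(2) by simp
  have "partition_entropy_rate M f P \<le> s'"
  proof (rule field_le_epsilon)
    fix e :: real assume "e > 0"
    then show "partition_entropy_rate M f P \<le> s' + e"
      using partition_entropy_rate_le_scale[OF cpt P s(2) s' freq, of "e / 3"] by simp
  qed
  then show "ereal (partition_entropy_rate M f P) \<le> ereal s'"
    by simp
qed

text \<open>At a fixed scale the entropy function is constant almost everywhere by ergodicity, so a
  partition of diameter below that scale has at least this rate. The scales
  \<open>1 / (n + 1)\<close> then give the local entropy.\<close>

lemma esssup_le_ks_entropy:
  assumes cpt: "compact (UNIV :: 'a set)"
    and erg: "\<And>A. A \<in> sets M \<Longrightarrow> f -` A \<inter> space M = A \<Longrightarrow> prob A = 0 \<or> prob A = 1"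
  shows "esssup M (local_entropy M f) \<le> ks_entropy M f"
proof -
  have le: "esssup M (scale_entropy \<epsilon>) \<le> ks_entropy M f" if \<epsilon>: "\<epsilon> > 0" for \<epsilon>
  proof (rule ccontr)
    assume "\<not> ?thesis"
    then obtain c where c: "ks_entropy M f < ereal c" "ereal c < esssup M (scale_entropy \<epsilon>)"
      using ereal_dense2 not_le by metis
    obtain P :: "'a set set" where P: "finite P" "partition_on UNIV P" "P \<subseteq> sets borel"
      "\<forall>A\<in>P. \<forall>x\<in>A. \<forall>y\<in>A. dist x y < \<epsilon>"
      using borel_partition_small_diameter[OF cpt \<epsilon>] by blast
    then have P': "P \<in> finite_measurable_partitions M"
      by (simp add: finite_measurable_partitions_def sets_M)
    have "AE x in M. scale_entropy \<epsilon> x = esssup M (scale_entropy \<epsilon>)"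
      by (rule AE_eq_esssup[OF erg scale_entropy_measurable scale_entropy_f_le])
    then have "AE x in M. ereal c < scale_entropy \<epsilon> x"
      by eventually_elim (simp add: c(2))
    then have "c \<le> partition_entropy_rate M f P"
      using P(4) by (intro partition_entropy_rate_ge[OF P', of \<epsilon>]) auto
    then have "ereal c \<le> ks_entropy M f"
      unfolding ks_entropy_def by (intro SUP_upper2[OF P']) simp
    then show False
      using c(1) by simp
  qed
  have "AE x in M. \<forall>n. scale_entropy (1 / real (Suc n)) x \<le> ks_entropy M f"
    unfolding AE_all_countable
  proof
    fix n
    show "AE x in M. scale_entropy (1 / real (Suc n)) x \<le> ks_entropy M f"
      using esssup_AE[of "scale_entropy (1 / real (Suc n))" M]
      by eventually_elim (rule order_trans[OF _ le], auto)
  qed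
  then have "AE x in M. local_entropy M f x \<le> ks_entropy M f"
    by eventually_elim (auto simp: local_entropy_eq_SUP_seq intro: SUP_least)
  then show ?thesis
    by (intro esssup_I local_entropy_measurable)
qed

end

theorem corollary4p2:
  fixes f :: "'a::metric_space \<Rightarrow> 'a" and \<mu> :: "'a measure"
  assumes "compact (UNIV :: 'a set)"
    and "continuous_on UNIV f"
    and "\<mu> \<in> invariant_measures f"
  shows "measure_pressure_zero \<mu> f = esssup \<mu> (local_entropy \<mu> f) \<and>
    (ergodic_measure f \<mu> \<longrightarrow>
      (AE x in \<mu>. local_entropy \<mu> f x = measure_pressure_zero \<mu> f \<and>
                  measure_pressure_zero \<mu> f = ks_entropy \<mu> f))"
proof -
  have \<mu>: "prob_space \<mu>" "sets \<mu> = sets borel" "f \<in> measurable \<mu> \<mu>" "distr \<mu> \<mu> f = \<mu>"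
    using assms(3) by (auto simp: invariant_measures_def)
  interpret prob_space \<mu>
    by fact
  interpret topological_system \<mu> f
    by unfold_locales (fact \<mu> assms)+
  have "AE x in \<mu>. local_entropy \<mu> f x = measure_pressure_zero \<mu> f \<and>
                  measure_pressure_zero \<mu> f = ks_entropy \<mu> f" if "ergodic_measure f \<mu>"
  proof -
    have erg: "prob A = 0 \<or> prob A = 1" if "A \<in> sets \<mu>" "f -` A \<inter> space \<mu> = A" for A
      using \<open>ergodic_measure f \<mu>\<close> that by (simp add: ergodic_measure_def)
    have "esssup \<mu> (local_entropy \<mu> f) = ks_entropy \<mu> f"
      using ks_entropy_le_esssup esssup_le_ks_entropy erg assms(1) by (intro antisym) auto
    moreover have "AE x in \<mu>. local_entropy \<mu> f x = esssup \<mu> (local_entropy \<mu> f)"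
      by (rule AE_eq_esssup[OF erg local_entropy_measurable local_entropy_f_le])
    ultimately show ?thesis
      by (simp add: measure_pressure_zero_eq_esssup)
  qed
  then show ?thesis
    using measure_pressure_zero_eq_esssup by blast
qed

end
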